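(* Suppose Assumptions 1–4 spelled out in the context hold (irreducible aperiodic Markov chain, reward variation bounded by $\delta^2$, normalized features, network connectivity) and $B_n\le q_n<\frac{N_n}{3}$ for the honest agents $n\in\mathcal N$. If the decreasing step size $\eta^k$ of the algorithm Byrd-TD($\lambda$) is chosen such that $$16N^2\Big(\frac{1+\gamma}{1-\gamma\lambda}\Big)^2(\eta^k)^2\le\frac{1-\mu}{2},\qquad 1\le\left(\frac{\eta^{k-1}}{\eta^{k}}\right)^2\le\frac{4}{3+\mu},$$ then, with $\bar{\bm\theta}^k:=\frac1N\sum_{n\in\mathcal N}\bm\theta_n^k$, the consensus error satisfies $$\frac1N\sum_{n\in\mathcal N}\left\|\bm\theta_n^k-\bar{\bm\theta}^k\right\|^2\le\frac12 C_1\mu_{\mathcal G}\left(\eta^k\right)^2,$$ where $$C_1:=\frac{128N^2\delta^2}{(1-\gamma\lambda)^2},\qquad \mu_{\mathcal G}:=\frac{1}{1-\mu},$$ and $\mu$ (defined in the context) increases as the network diameter $\tau_{\mathcal G}$ increases.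
   Context: **Network.** $\mathcal N$ and $\mathcal B$ are disjoint finite sets of honest and Byzantine agents, $N=|\mathcal N|$. $\mathcal G=(\mathcal N\cup\mathcal B,\mathcal E)$ is a directed graph without self-links; $(m,n)\in\mathcal E$ means $m$ can send to $n$. For $n\in\mathcal N$, $\mathcal N_n=\{m\in\mathcal N:(m,n)\in\mathcal E\}$, $\mathcal B_n=\{m\in\mathcal B:(m,n)\in\mathcal E\}$, $N_n=|\mathcal N_n|$, $B_n=|\mathcal B_n|$. Each honest agent $n$ chooses a trimming number $q_n$ (an integer). **Markov reward process.** $\mathcal S$ is a set of states with transition probabilities $\mathcal P(s,s')$, initial distribution $\rho^0$, discount factor $\gamma\in(0,1)$, and local rewards $\mathcal R_n(s,s')$, $n\in\mathcal N$. $(s^k)_{k\ge0}$ is the Markov chain with these transitions and initial law; $r_n^k:=\mathcal R_n(s^k,s^{k+1})$. $\bm\phi(s)\in\mathbb R^D$ is the feature vector of state $s$; $\lambda\in[0,1]$. **Algorithm Byrd-TD($\lambda$).** Start with $\bm\theta_n^0=\bm\theta^0\in\mathbb R^D$ for all $n\in\mathcal N$ and $\bm z^{-1}=\bm0$. For $k=0,1,2,\dots$: set $\bm z^k=\gamma\lambda\bm z^{k-1}+\bm\phi(s^k)$ and $\bm g_n^k(\bm\theta):=\left(r_n^k+(\gamma\bm\phi(s^{k+1})-\bm\phi(s^k))^\top\bm\theta\right)\bm z^k$. Honest agent $n$ receives $\bm\theta_m^k$ from every $m\in\mathcal N_n\cup\mathcal B_n$: the true current iterate if $m\in\mathcal N_n$,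 an arbitrary vector if $m\in\mathcal B_n$. For each coordinate $d$, $\mathcal N_n^{k-}(d)$ and $\mathcal N_n^{k+}(d)$ are the sets of $q_n$ indices in $\mathcal N_n\cup\mathcal B_n$ with the smallest, resp. largest, values $[\bm\theta_m^k]_d$, and $\mathcal N_n^{k*}(d)$ is the set of remaining indices of $\mathcal N_n\cup\mathcal B_n$. With step size $\eta^k>0$, update $$[\bm\theta_n^{k+1}]_d=\frac{1}{N_n+B_n-2q_n+1}\sum_{m\in\mathcal N_n^{k*}(d)\cup\{n\}}[\bm\theta_m^k]_d+\eta^k[\bm g_n^k(\bm\theta_n^k)]_d .$$ **Assumptions.** (1) The Markov chain is irreducible and aperiodic. (2) For any transition $s\to s'$: $\frac1N\sum_{n\in\mathcal N}\big\|\mathcal R_n(s,s')-\frac1N\sum_{n'\in\mathcal N}\mathcal R_{n'}(s,s')\big\|^2\le\delta^2$. (3) $\|\bm\phi(s)\|\le1$ for all $s\in\mathcal S$. (4) Let $\mathcal H_{\mathcal G}$ be the set whose elements are the subgraphs of $\mathcal G$ obtained by removing all Byzantine agents with their edges, and removing any additional $q_n$ incoming edges at every honest node $n$; $H_{\mathcal G}=|\mathcal H_{\mathcal G}|$. For any $\mathcal G'\in\mathcal H_{\mathcal G}$ there is at least one agent $n^*$ which has directed paths to all nodes in $\mathcal G'$, and the length of the paths is no more than $\tau_{\mathcal G}$ (called the network diameter). **The quantity $\mu$.** $$\mu:=\left(1-\mu_0^{\tau_{\mathcal G}H_{\mathcal G}}\right)^{\frac{2}{\tau_{\mathcal G}H_{\mathcal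 G}}},\qquad \mu_0:=\min_{n\in\mathcal N}\left[\min\left\{\frac{N_n+B_n-3q_n}{N_n-2q_n},\ \frac{(N_n+B_n-2q_n)(q_n-B_n)}{(N_n-q_n)^2}\right\}\times\frac{1}{N_n+B_n-2q_n+1}\right].$$ *)

theory Defs
  imports "HOL-Probability.Probability"
begin

section \<open>The network\<close>

text \<open>An edge \<open>(m, n) \<in> E\<close> means that \<open>m\<close> can send to \<open>n\<close>.\<close>

definition agent_network :: "'a set \<Rightarrow> 'a set \<Rightarrow> ('a \<times> 'a) set \<Rightarrow> bool" where
  "agent_network Hon Byz E \<longleftrightarrow>
     finite Hon \<and> finite Byz \<and> Hon \<inter> Byz = {} \<and>
     E \<subseteq> (Hon \<union> Byz) \<times> (Hon \<union> Byz) \<and> irrefl E"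

definition in_nbrs :: "('a \<times> 'a) set \<Rightarrow> 'a set \<Rightarrow> 'a \<Rightarrow> 'a set" where
  "in_nbrs E A n = {m \<in> A. (m, n) \<in> E}"

text \<open>All these subgraphs have the vertex set \<open>Hon\<close>, so each of them is identified with its
  edge set.\<close>

definition reduced_graphs :: "'a set \<Rightarrow> ('a \<times> 'a) set \<Rightarrow> ('a \<Rightarrow> nat) \<Rightarrow> ('a \<times> 'a) set set" where
  "reduced_graphs Hon E q =
     {E'. E' \<subseteq> E \<inter> Hon \<times> Hon \<and>
          (\<forall>n\<in>Hon. card {m. (m, n) \<in> E \<inter> Hon \<times> Hon - E'} = q n)}"

definition rooted_within :: "'a set \<Rightarrow> nat \<Rightarrow> ('a \<times> 'a) set \<Rightarrow> bool" where
  "rooted_within V \<tau> E' \<longleftrightarrow> (\<exists>r\<in>V. \<forall>n\<in>V. \<exists>j\<le>\<tau>. (r, n) \<in> E' ^^ j)"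

definition mu0 :: "'a set \<Rightarrow> 'a set \<Rightarrow> ('a \<times> 'a) set \<Rightarrow> ('a \<Rightarrow> nat) \<Rightarrow> real" where
  "mu0 Hon Byz E q =
     (MIN n\<in>Hon.
        let Nn = real (card (in_nbrs E Hon n)); Bn = real (card (in_nbrs E Byz n));
            qn = real (q n)
        in min ((Nn + Bn - 3 * qn) / (Nn - 2 * qn))
               ((Nn + Bn - 2 * qn) * (qn - Bn) / (Nn - qn)\<^sup>2)
           * (1 / (Nn + Bn - 2 * qn + 1)))"

definition mu :: "'a set \<Rightarrow> 'a set \<Rightarrow> ('a \<times> 'a) set \<Rightarrow> ('a \<Rightarrow> nat) \<Rightarrow> nat \<Rightarrow> real" where
  "mu Hon Byz E q \<tau> =
     (let H = card (reduced_graphs Hon E q)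
      in (1 - mu0 Hon Byz E q ^ (\<tau> * H)) powr (2 / real (\<tau> * H)))"

section \<open>The Markov chain\<close>

text \<open>The state space is the whole type \<open>'s\<close>; the probability of moving from \<open>s\<close> to \<open>s'\<close>
  is \<open>pmf (P s) s'\<close>.\<close>

definition markov_chain ::
    "'w measure \<Rightarrow> 's pmf \<Rightarrow> ('s \<Rightarrow> 's pmf) \<Rightarrow> (nat \<Rightarrow> 'w \<Rightarrow> 's) \<Rightarrow> bool" where
  "markov_chain M \<rho>0 P X \<longleftrightarrow>
     prob_space M \<and> (\<forall>k. X k \<in> M \<rightarrow>\<^sub>M count_space UNIV) \<and>
     (\<forall>k x. measure M {\<omega> \<in> space M. \<forall>i\<le>k. X i \<omega> = x i} =
            pmf \<rho>0 (x 0) * (\<Prod>i<k. pmf (P (x i)) (x (Suc i))))"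

primrec n_step :: "('s \<Rightarrow> 's pmf) \<Rightarrow> nat \<Rightarrow> 's \<Rightarrow> 's pmf" where
  "n_step P 0 s = return_pmf s"
| "n_step P (Suc k) s = bind_pmf (P s) (n_step P k)"

definition irreducible_kernel :: "('s \<Rightarrow> 's pmf) \<Rightarrow> bool" where
  "irreducible_kernel P \<longleftrightarrow> (\<forall>s s'. \<exists>k. pmf (n_step P k s) s' > 0)"

definition aperiodic_kernel :: "('s \<Rightarrow> 's pmf) \<Rightarrow> bool" where
  "aperiodic_kernel P \<longleftrightarrow> (\<forall>s. Gcd {k. 0 < k \<and> pmf (n_step P k s) s > 0} = 1)"

section \<open>Byrd-TD($\lambda$)\<close>

text \<open>With the convention that the trace at time \<open>-1\<close> is \<open>0\<close>, its value at time \<open>0\<close>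
  is \<open>\<phi> (s 0)\<close>. The factor \<open>c\<close> will be $\gamma\lambda$.\<close>

primrec elig_trace :: "real \<Rightarrow> ('s \<Rightarrow> real ^ 'd) \<Rightarrow> (nat \<Rightarrow> 's) \<Rightarrow> nat \<Rightarrow> real ^ 'd" where
  "elig_trace c \<phi> s 0 = \<phi> (s 0)"
| "elig_trace c \<phi> s (Suc k) = c *\<^sub>R elig_trace c \<phi> s k + \<phi> (s (Suc k))"

definition td_dir ::
    "real \<Rightarrow> real \<Rightarrow> ('s \<Rightarrow> real ^ 'd) \<Rightarrow> ('s \<Rightarrow> 's \<Rightarrow> real) \<Rightarrow> (nat \<Rightarrow> 's) \<Rightarrow> nat \<Rightarrow>
     real ^ 'd \<Rightarrow> real ^ 'd" where
  "td_dir \<gamma> lam \<phi> Rn s k \<theta> =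
     (Rn (s k) (s (Suc k)) + (\<gamma> *\<^sub>R \<phi> (s (Suc k)) - \<phi> (s k)) \<bullet> \<theta>)
       *\<^sub>R elig_trace (\<gamma> * lam) \<phi> s k"

text \<open>\<open>L\<close> and \<open>U\<close> are \<open>q\<close> indices of \<open>A\<close> with the smallest and with the largest values.
  Ties are broken arbitrarily, but no index may be trimmed twice.\<close>

definition trim_sets :: "('a \<Rightarrow> real) \<Rightarrow> nat \<Rightarrow> 'a set \<Rightarrow> 'a set \<Rightarrow> 'a set \<Rightarrow> bool" where
  "trim_sets v q A L U \<longleftrightarrow>
     L \<subseteq> A \<and> U \<subseteq> A \<and> L \<inter> U = {} \<and> card L = q \<and> card U = q \<and>
     (\<forall>i\<in>L. \<forall>j\<in>A - L. v i \<le> v j) \<and> (\<forall>i\<in>U. \<forall>j\<in>A - U. v j \<le> v i)"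

text \<open>\<open>b k m n\<close> is what the Byzantine agent \<open>m\<close> sends to the honest agent \<open>n\<close> at time \<open>k\<close>;
  it may depend on the receiver.\<close>

definition received ::
    "'a set \<Rightarrow> (nat \<Rightarrow> 'a \<Rightarrow> 'v) \<Rightarrow> (nat \<Rightarrow> 'a \<Rightarrow> 'a \<Rightarrow> 'v) \<Rightarrow> nat \<Rightarrow> 'a \<Rightarrow> 'a \<Rightarrow> 'v" where
  "received Hon \<theta> b k n m = (if m \<in> Hon then \<theta> k m else b k m n)"

text \<open>\<open>\<theta> k n\<close> is the iterate of the honest agent \<open>n\<close> at time \<open>k\<close> along the state path \<open>s\<close>.\<close>

definition byrd_td ::
    "'a set \<Rightarrow> 'a set \<Rightarrow> ('a \<times> 'a) set \<Rightarrow> ('a \<Rightarrow> nat) \<Rightarrow> real \<Rightarrow> real \<Rightarrow> ('s \<Rightarrow> real ^ 'd) \<Rightarrow>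
     ('a \<Rightarrow> 's \<Rightarrow> 's \<Rightarrow> real) \<Rightarrow> (nat \<Rightarrow> real) \<Rightarrow> real ^ 'd \<Rightarrow> (nat \<Rightarrow> 's) \<Rightarrow>
     (nat \<Rightarrow> 'a \<Rightarrow> 'a \<Rightarrow> real ^ 'd) \<Rightarrow> (nat \<Rightarrow> 'a \<Rightarrow> real ^ 'd) \<Rightarrow> bool" where
  "byrd_td Hon Byz E q \<gamma> lam \<phi> R \<eta> \<theta>0 s b \<theta> \<longleftrightarrow>
     (\<forall>n\<in>Hon. \<theta> 0 n = \<theta>0) \<and>
     (\<forall>k. \<forall>n\<in>Hon. \<forall>d. \<exists>L U.
        trim_sets (\<lambda>m. received Hon \<theta> b k n m $ d) (q n) (in_nbrs E (Hon \<union> Byz) n) L U \<and>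
        \<theta> (Suc k) n $ d =
          1 / (real (card (in_nbrs E Hon n)) + real (card (in_nbrs E Byz n)) - 2 * real (q n) + 1)
            * (\<Sum>m\<in>(in_nbrs E (Hon \<union> Byz) n - (L \<union> U)) \<union> {n}. received Hon \<theta> b k n m $ d)
          + \<eta> k * td_dir \<gamma> lam \<phi> (R n) s k (\<theta> k n) $ d)"

definition avg :: "'a set \<Rightarrow> ('a \<Rightarrow> 'v::real_vector) \<Rightarrow> 'v" where
  "avg A f = (1 / real (card A)) *\<^sub>R (\<Sum>n\<in>A. f n)"

end

theory Submission imports Defs begin

text \<open>Let \<open>V\<^sub>k\<close> be the Euclidean norm, over the coordinates, of the spread (maximum minus minimum over
  the honest agents) of the iterates. The temporal-difference directions of all agents are multiples
  of the same eligibility trace, so their contribution to the growth of \<open>V\<^sub>k\<close> does not depend on the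
  dimension. A trimmed mean of a coordinate is an average of honest values that gives weight at least
  \<open>w = 1 / (4 N\<^sup>2)\<close> to the agent itself and to its neighbours in some reduced graph. Since every
  reduced graph is rooted, any \<open>N\<^sup>2\<close> consecutive such averages contract all spreads by the factor
  \<open>1 - w ^ N\<^sup>2\<close>.

  The step sizes are small only compared with \<open>sqrt (1 - mu)\<close>, and not with \<open>1 - mu\<close>, so a
  contraction rate of \<open>mu\<close> would not suffice. But a positive step size forces \<open>mu < 1\<close>, so \<open>B\<^sub>n < q\<^sub>n\<close> for
  all \<open>n\<close>, hence \<open>N \<ge> 5\<close> and at least \<open>4 ^ N\<close> reduced graphs, and then \<open>N\<^sup>2 sqrt (1 - mu) \<le> w ^ N\<^sup>2\<close>.\<close>

section \<open>Products of averages\<close>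

text \<open>The maximum over ordered pairs reduces an upper bound to a statement about two agents.
  The value on the empty set carries no meaning, hence the nonemptiness assumptions below.\<close>

definition spread :: "'a set \<Rightarrow> ('a \<Rightarrow> real) \<Rightarrow> real" where
  "spread A f = Max ((\<lambda>(n, m). f n - f m) ` (A \<times> A))"

lemma diff_le_spread:
  assumes "finite A" "n \<in> A" "m \<in> A"
  shows "f n - f m \<le> spread A f"
  unfolding spread_def using assms by (intro Max_ge) auto

lemma abs_diff_le_spread:
  assumes "finite A" "n \<in> A" "m \<in> A"
  shows "\<bar>f n - f m\<bar> \<le> spread A f"
  using diff_le_spread[of A n m f] diff_le_spread[of A m n f] assms by auto

lemma spread_le:
  assumes "finite A" "A \<noteq> {}" "\<And>n m. n \<in> A \<Longrightarrow> m \<in> A \<Longrightarrow> f n - f m \<le> c"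
  shows "spread A f \<le> c"
  unfolding spread_def using assms by (intro Max.boundedI) auto

lemma spread_nonneg: "finite A \<Longrightarrow> A \<noteq> {} \<Longrightarrow> 0 \<le> spread A f"
  using diff_le_spread[of A _ _ f] by fastforce

lemma spread_add_le:
  assumes "finite A" "A \<noteq> {}" "\<And>n. n \<in> A \<Longrightarrow> h n = f n + g n"
  shows "spread A h \<le> spread A f + spread A g"
proof (rule spread_le[OF assms(1,2)])
  fix n m assume "n \<in> A" "m \<in> A"
  then show "h n - h m \<le> spread A f + spread A g"
    using diff_le_spread[of A n m f] diff_le_spread[of A n m g] assms by simp
qed

text \<open>A row-stochastic matrix on \<open>A\<close>: row \<open>n\<close> holds the weights used
  by agent \<open>n\<close>.\<close>

definition averaging :: "'a set \<Rightarrow> ('a \<Rightarrow> 'a \<Rightarrow> real) \<Rightarrow> bool" where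
  "averaging A Y \<longleftrightarrow> (\<forall>n\<in>A. (\<forall>m\<in>A. 0 \<le> Y n m) \<and> sum (Y n) A = 1)"

lemma averaging_le:
  assumes "averaging A Y" "n \<in> A" "\<And>m. m \<in> A \<Longrightarrow> f m \<le> c"
  shows "(\<Sum>m\<in>A. Y n m * f m) \<le> c"
proof -
  have "(\<Sum>m\<in>A. Y n m * f m) \<le> (\<Sum>m\<in>A. Y n m * c)"
    using assms by (intro sum_mono mult_left_mono) (auto simp: averaging_def)
  also have "\<dots> = c" using assms by (simp add: averaging_def flip: sum_distrib_right)
  finally show ?thesis .
qed

lemma averaging_ge:
  assumes "averaging A Y" "n \<in> A" "\<And>m. m \<in> A \<Longrightarrow> c \<le> f m"
  shows "c \<le> (\<Sum>m\<in>A. Y n m * f m)"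
  using averaging_le[of A Y n "\<lambda>m. - f m" "- c"] assms by (simp add: sum_negf)

lemma spread_averaging_le:
  assumes "finite A" "A \<noteq> {}" "averaging A Y"
  shows "spread A (\<lambda>n. \<Sum>m\<in>A. Y n m * f m) \<le> spread A f"
proof (rule spread_le[OF assms(1,2)])
  fix n n' assume n: "n \<in> A" "n' \<in> A"
  have "(\<Sum>m\<in>A. Y n m * f m) \<le> spread A f + (\<Sum>m\<in>A. Y n' m * f m)"
  proof (rule averaging_le[OF assms(3) n(1)])
    fix m assume m: "m \<in> A"
    have "f m - spread A f \<le> (\<Sum>m\<in>A. Y n' m * f m)"
      using diff_le_spread[OF assms(1) m, of _ f]
      by (intro averaging_ge[OF assms(3) n(2)]) (simp add: algebra_simps)
    then show "f m \<le> spread A f + (\<Sum>m\<in>A. Y n' m * f m)" by simp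
  qed
  then show "(\<Sum>m\<in>A. Y n m * f m) - (\<Sum>m\<in>A. Y n' m * f m) \<le> spread A f" by simp
qed

text \<open>The matrix product \<open>Y (j - 1) ... Y 0\<close>, with the newest factor on the left.
  Entry \<open>(n, r)\<close> is the weight of the initial value of \<open>r\<close> in the value of
  \<open>n\<close> after \<open>j\<close> steps.\<close>

primrec avg_prod :: "'a set \<Rightarrow> (nat \<Rightarrow> 'a \<Rightarrow> 'a \<Rightarrow> real) \<Rightarrow> nat \<Rightarrow> 'a \<Rightarrow> 'a \<Rightarrow> real" where
  "avg_prod A Y 0 = (\<lambda>n r. if n = r then 1 else 0)"
| "avg_prod A Y (Suc j) = (\<lambda>n r. \<Sum>m\<in>A. Y j n m * avg_prod A Y j m r)"

lemma averaging_avg_prod: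
  assumes "finite A" "\<And>j. averaging A (Y j)"
  shows "averaging A (avg_prod A Y j)"
proof (induction j)
  case 0
  then show ?case using assms(1) by (auto simp: averaging_def)
next
  case (Suc j)
  have "(\<Sum>r\<in>A. avg_prod A Y (Suc j) n r) = 1" if "n \<in> A" for n
  proof -
    have "(\<Sum>r\<in>A. avg_prod A Y (Suc j) n r) = (\<Sum>m\<in>A. Y j n m * (\<Sum>r\<in>A. avg_prod A Y j m r))"
      by (simp add: sum_distrib_left) (rule sum.swap)
    also have "\<dots> = (\<Sum>m\<in>A. Y j n m)"
      using Suc by (intro sum.cong) (auto simp: averaging_def)
    finally show ?thesis using assms(2) that by (simp add: averaging_def)
  qed
  moreover have "0 \<le> avg_prod A Y (Suc j) n r" if "n \<in> A" "r \<in> A" for n r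
    using Suc assms(2)[of j] that by (auto simp: averaging_def intro!: sum_nonneg)
  ultimately show ?case unfolding averaging_def by blast
qed

text \<open>The edge \<open>(m, n)\<close> stands for row \<open>n\<close> giving weight to
  \<open>m\<close>, so edges follow the flow of information, as in \<open>E\<close>. The bound on
  the diagonal lets an agent retain what it has received.\<close>

definition mixing :: "'a set \<Rightarrow> real \<Rightarrow> ('a \<Rightarrow> 'a \<Rightarrow> real) \<Rightarrow> bool" where
  "mixing A w Y \<longleftrightarrow> averaging A Y \<and> (\<forall>n\<in>A. w \<le> Y n n) \<and>
     (\<exists>r\<in>A. \<forall>n\<in>A. (r, n) \<in> {(m, n). m \<in> A \<and> n \<in> A \<and> w \<le> Y n m}\<^sup>*)"

lemma avg_prod_Suc_ge:
  assumes "finite A" "\<And>j. averaging A (Y j)" "n \<in> A" "m \<in> A" "r \<in> A"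
    and "0 \<le> w" "w \<le> Y j n m" "w ^ j \<le> avg_prod A Y j m r"
  shows "w ^ Suc j \<le> avg_prod A Y (Suc j) n r"
proof -
  note * = averaging_avg_prod[where Y=Y and j=j, OF assms(1,2)]
  have "w ^ Suc j \<le> Y j n m * avg_prod A Y j m r"
    using assms(6-8) by (auto intro!: mult_mono)
  also have "\<dots> \<le> (\<Sum>m\<in>A. Y j n m * avg_prod A Y j m r)"
    using assms(1,3-5) assms(2)[of j] *
    by (intro member_le_sum) (auto simp: averaging_def)
  finally show ?thesis by simp
qed

text \<open>The sets of agents that have received weight \<open>w ^ j\<close> from \<open>r\<close> never shrink, and the one of
  the root of the current step grows strictly until it is everything. Summing their sizes over
  all \<open>r\<close>, this can happen at most \<open>(card A)\<^sup>2\<close> times before one of them is full.\<close>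

lemma avg_prod_column_ge:
  fixes w :: real
  assumes fin: "finite A" and ne: "A \<noteq> {}" and mix: "\<And>j. mixing A w (Y j)" and w: "0 < w"
  shows "\<exists>r\<in>A. \<forall>n\<in>A. w ^ (card A * card A) \<le> avg_prod A Y (card A * card A) n r"
proof -
  define S where "S j r = {n \<in> A. w ^ j \<le> avg_prod A Y j n r}" for j r
  have avgY: "averaging A (Y j)" for j using mix by (simp add: mixing_def)
  have finS: "finite (S j r)" for j r using fin by (simp add: S_def)
  have spreads: "n \<in> S (Suc j) r" if "m \<in> S j r" "n \<in> A" "r \<in> A" "w \<le> Y j n m" for n m j r
    using avg_prod_Suc_ge[where Y=Y and j=j and n=n and m=m and r=r and w=w, OF fin avgY] that w by (simp add: S_def)
  have mono: "S j r \<subseteq> S (Suc j) r" if "r \<in> A" for j r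
  proof
    fix n assume "n \<in> S j r"
    then show "n \<in> S (Suc j) r"
      using spreads[of n j r n] mix[of j] that by (auto simp: mixing_def S_def)
  qed
  have self: "r \<in> S j r" if "r \<in> A" for j r
  proof (induction j)
    case 0
    then show ?case using that by (simp add: S_def)
  next
    case (Suc j)
    then show ?case using mono[OF that] by blast
  qed
  have grow: "\<exists>r\<in>A. S j r = A \<or> S j r \<subset> S (Suc j) r" for j
  proof -
    define F where "F = {(m, n). m \<in> A \<and> n \<in> A \<and> w \<le> Y j n m}"
    obtain r where r: "r \<in> A" "\<And>n. n \<in> A \<Longrightarrow> (r, n) \<in> F\<^sup>*"
      using mix[of j] unfolding mixing_def F_def by blast
    \<comment> \<open>If the set of the root stagnates, it is closed under the edges of
      \<open>F\<close>; as it contains the root, it contains everything reachable from it.\<close>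
    have "S j r = A" if eq: "S (Suc j) r = S j r"
    proof -
      have "n \<in> S j r" if "(r, n) \<in> F\<^sup>*" for n
        using that
      proof (induction rule: rtrancl_induct)
        case base
        then show ?case using self r by simp
      next
        case (step m n)
        then show ?case using spreads[of m j r n] eq r(1)
          by (auto simp: F_def)
      qed
      then show ?thesis using r(2) by (auto simp: S_def)
    qed
    then show ?thesis using mono[OF r(1), of j] r(1) by blast
  qed
  \<comment> \<open>The total size is at least 1 at time 0, because an agent has weight 1 on itself,
    and each step without a full set raises it. At time \<open>card A * card A\<close> the second
    alternative would exceed the largest possible total.\<close>
  have "(\<exists>r\<in>A. S j r = A) \<or> j + 1 \<le> (\<Sum>r\<in>A. card (S j r))" for j
  proof (induction j)
    case 0
    obtain r where r: "r \<in> A" using ne by blast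
    have "card (S 0 r) \<noteq> 0" using self[OF r, of 0] finS by auto
    then show ?case using member_le_sum[of r A "\<lambda>r. card (S 0 r)"] r fin by simp
  next
    case (Suc j)
    show ?case
    proof (cases "\<exists>r\<in>A. S j r = A")
      case True
      then show ?thesis using mono[of _ j] by (auto simp: S_def)
    next
      case False
      then obtain r where r: "r \<in> A" "S j r \<subset> S (Suc j) r" using grow by blast
      have "(\<Sum>r\<in>A. card (S j r)) < (\<Sum>r\<in>A. card (S (Suc j) r))"
        using fin r mono by (intro sum_strict_mono_ex1) (auto intro!: card_mono finS psubset_card_mono bexI[of _ r])
      then show ?thesis using Suc False by linarith
    qed
  qed
  from this[of "card A * card A"] show ?thesis
  proof
    assume "card A * card A + 1 \<le> (\<Sum>r\<in>A. card (S (card A * card A) r))"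
    also have "\<dots> \<le> (\<Sum>r\<in>A. card A)"
      by (intro sum_mono card_mono fin) (auto simp: S_def)
    finally show ?thesis by simp
  qed (auto simp: S_def)
qed

text \<open>All rows of the product put weight at least \<open>w ^ L\<close> on a common column
  \<open>r\<close>. This shared part contributes the same amount to every agent and cancels in
  differences; the rest of each row has total weight \<open>1 - w ^ L\<close>.\<close>

lemma spread_avg_prod_le:
  fixes w :: real
  assumes fin: "finite A" and ne: "A \<noteq> {}" and mix: "\<And>j. mixing A w (Y j)" and w: "0 < w"
  shows "spread A (\<lambda>n. \<Sum>r\<in>A. avg_prod A Y (card A * card A) n r * f r)
           \<le> (1 - w ^ (card A * card A)) * spread A f"
proof -
  define L where "L = card A * card A"
  define Q where "Q = avg_prod A Y L"
  have avgQ: "averaging A Q"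
    unfolding Q_def using mix by (intro averaging_avg_prod fin) (simp add: mixing_def)
  obtain r where r: "r \<in> A" "\<And>n. n \<in> A \<Longrightarrow> w ^ L \<le> Q n r"
    using avg_prod_column_ge[where Y=Y, OF assms] unfolding L_def Q_def by blast
  define Q' where "Q' n m = Q n m - (if m = r then w ^ L else 0)" for n m
  have Q'0: "0 \<le> Q' n m" if "n \<in> A" "m \<in> A" for n m
    using r avgQ that by (auto simp: Q'_def averaging_def)
  have Q'1: "sum (Q' n) A = 1 - w ^ L" if "n \<in> A" for n
    using avgQ that r(1) fin by (simp add: Q'_def averaging_def sum_subtractf)
  have split: "(\<Sum>m\<in>A. Q n m * f m) = (\<Sum>m\<in>A. Q' n m * f m) + w ^ L * f r" for n
    using r(1) fin by (simp add: Q'_def left_diff_distrib sum_subtractf if_distrib[of "\<lambda>x. x * _"] cong: if_cong)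
  obtain lo where lo: "lo \<in> A" "\<And>m. m \<in> A \<Longrightarrow> f lo \<le> f m"
    using fin ne by (meson arg_min_if_finite(1) arg_min_least)
  obtain hi where hi: "hi \<in> A" "\<And>m. m \<in> A \<Longrightarrow> f m \<le> f hi"
    using lo fin ne arg_min_if_finite(1)[of A "\<lambda>m. - f m"] arg_min_least[of A _ "\<lambda>m. - f m"]
    by (metis neg_le_iff_le)
  have "spread A (\<lambda>n. \<Sum>m\<in>A. Q n m * f m) \<le> (1 - w ^ L) * (f hi - f lo)"
  proof (rule spread_le[OF fin ne])
    fix n n' assume n: "n \<in> A" "n' \<in> A"
    have "(\<Sum>m\<in>A. Q' n m * f m) \<le> (\<Sum>m\<in>A. Q' n m * f hi)"
      using n hi Q'0 by (intro sum_mono mult_left_mono) auto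
    also have "\<dots> = (1 - w ^ L) * f hi" using Q'1 n by (simp flip: sum_distrib_right)
    finally have 1: "(\<Sum>m\<in>A. Q' n m * f m) \<le> (1 - w ^ L) * f hi" .
    have "(1 - w ^ L) * f lo = (\<Sum>m\<in>A. Q' n' m * f lo)"
      using Q'1 n by (simp flip: sum_distrib_right)
    also have "\<dots> \<le> (\<Sum>m\<in>A. Q' n' m * f m)"
      using n lo Q'0 by (intro sum_mono mult_left_mono) auto
    finally show "(\<Sum>m\<in>A. Q n m * f m) - (\<Sum>m\<in>A. Q n' m * f m) \<le> (1 - w ^ L) * (f hi - f lo)"
      using 1 by (simp add: split right_diff_distrib)
  qed
  also have "\<dots> \<le> (1 - w ^ L) * spread A f"
    using Q'1[OF r(1)] sum_nonneg[of A "Q' r"] Q'0 r(1) diff_le_spread[OF fin hi(1) lo(1), of f]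
    by (intro mult_left_mono) auto
  finally show ?thesis by (simp add: Q_def L_def)
qed

text \<open>The run is compared with the unperturbed run \<open>y\<close> from the same start. Their
  difference obeys the same recursion, starts at 0 and gains at most \<open>spread A (e j)\<close>
  in step \<open>j\<close>, because averaging does not increase spreads.\<close>

lemma
  fixes w :: real
  assumes fin: "finite A" and ne: "A \<noteq> {}" and mix: "\<And>j. mixing A w (Y j)" and w: "0 < w"
    and x: "\<And>j n. n \<in> A \<Longrightarrow> x (Suc j) n = (\<Sum>m\<in>A. Y j n m * x j m) + e j n"
  shows spread_perturbed_le: "spread A (x j) \<le> spread A (x 0) + (\<Sum>i<j. spread A (e i))"
    and spread_perturbed_contract: "spread A (x (card A * card A)) \<le>
      (1 - w ^ (card A * card A)) * spread A (x 0) + (\<Sum>i<card A * card A. spread A (e i))"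
proof -
  have avgY: "averaging A (Y j)" for j using mix by (simp add: mixing_def)
  define y where "y j n = (\<Sum>r\<in>A. avg_prod A Y j n r * x 0 r)" for j n
  have y0: "y 0 n = x 0 n" if "n \<in> A" for n
    using that fin by (simp add: y_def if_distrib[of "\<lambda>x. x * _"] cong: if_cong)
  have ySuc: "y (Suc j) n = (\<Sum>m\<in>A. Y j n m * y j m)" for j n
  proof -
    have "y (Suc j) n = (\<Sum>r\<in>A. \<Sum>m\<in>A. Y j n m * avg_prod A Y j m r * x 0 r)"
      by (simp add: y_def sum_distrib_right)
    also have "\<dots> = (\<Sum>m\<in>A. \<Sum>r\<in>A. Y j n m * avg_prod A Y j m r * x 0 r)"
      by (rule sum.swap)
    finally show ?thesis by (simp add: y_def sum_distrib_left mult.assoc)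
  qed
  have diff: "spread A (\<lambda>n. x j n - y j n) \<le> (\<Sum>i<j. spread A (e i))" for j
  proof (induction j)
    case 0
    show ?case using y0 by (intro spread_le[OF fin ne]) simp
  next
    case (Suc j)
    have "spread A (\<lambda>n. x (Suc j) n - y (Suc j) n)
            \<le> spread A (\<lambda>n. \<Sum>m\<in>A. Y j n m * (x j m - y j m)) + spread A (e j)"
      by (intro spread_add_le[OF fin ne])
        (simp add: x ySuc right_diff_distrib sum_subtractf)
    also have "\<dots> \<le> spread A (\<lambda>n. x j n - y j n) + spread A (e j)"
      using spread_averaging_le[OF fin ne avgY] by (simp add: add_right_mono)
    finally show ?case using Suc by simp
  qed
  have tri: "spread A (x j) \<le> spread A (y j) + (\<Sum>i<j. spread A (e i))" for j
    using spread_add_le[OF fin ne, of "x j" "y j" "\<lambda>n. x j n - y j n"] diff[of j] by simp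
  have "spread A (y j) \<le> spread A (x 0)"
    unfolding y_def by (intro spread_averaging_le[OF fin ne] averaging_avg_prod fin avgY)
  with tri[of j] show "spread A (x j) \<le> spread A (x 0) + (\<Sum>i<j. spread A (e i))" by simp
  have "spread A (y (card A * card A)) \<le> (1 - w ^ (card A * card A)) * spread A (x 0)"
    unfolding y_def by (rule spread_avg_prod_le[where Y=Y, OF fin ne mix w])
  with tri[of "card A * card A"] show "spread A (x (card A * card A)) \<le>
      (1 - w ^ (card A * card A)) * spread A (x 0) + (\<Sum>i<card A * card A. spread A (e i))" by simp
qed

section \<open>Trimmed means\<close>

lemma convex_combination_ex:
  fixes a b s :: real
  assumes "a \<le> s" "s \<le> b"
  shows "\<exists>t. 0 \<le> t \<and> t \<le> 1 \<and> s = t * a + (1 - t) * b"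
proof (cases "a = b")
  case True
  then show ?thesis using assms by (intro exI[of _ 1]) auto
next
  case False
  define t where "t = (b - s) / (b - a)"
  have "t * (b - a) = b - s" using False by (simp add: t_def)
  then have "s = t * a + (1 - t) * b" by (simp add: algebra_simps)
  moreover have "0 \<le> t" "t \<le> 1" using False assms by (auto simp: t_def divide_le_eq)
  ultimately show ?thesis by blast
qed

lemma sum_of_bool_mult:
  fixes f :: "'a \<Rightarrow> real"
  assumes "finite A" "X \<subseteq> A"
  shows "(\<Sum>m\<in>A. c * of_bool (m \<in> X) * f m) = c * sum f X"
proof -
  have "(\<Sum>m\<in>A. c * of_bool (m \<in> X) * f m) = (\<Sum>m\<in>A. if m \<in> X then c * f m else 0)"
    by (intro sum.cong) auto
  also have "\<dots> = (\<Sum>m\<in>X. c * f m)"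
    using assms by (simp add: sum.inter_restrict[symmetric] Int_absorb1)
  finally show ?thesis by (simp add: sum_distrib_left)
qed

text \<open>Half of the weight of each surviving honest value, and all the weight of each surviving
  Byzantine value, is moved to the trimmed honest neighbours: every surviving value lies between
  the average over the honest agents trimmed from below and the one over those trimmed from above.
  At least one of these two groups then gets at least half of the moved weight.\<close>

lemma trimmed_mean_as_honest_average:
  fixes v :: "'a \<Rightarrow> real"
  assumes fin: "finite Hon" "finite Nb" and Nh: "Nh \<subseteq> Hon" and n: "n \<in> Hon" "n \<notin> Nh"
    and disj: "Nh \<inter> Nb = {}" and q: "card Nb < q" "3 * q < card Nh"
    and trim: "trim_sets v q (Nh \<union> Nb) L U" and notb: "n \<notin> Nb"
  shows "\<exists>Y G. (\<forall>m. 0 \<le> Y m) \<and> sum Y Hon = 1 \<and>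
      (\<Sum>m\<in>Hon. Y m * v m) =
        1 / (real (card Nh) + real (card Nb) - 2 * real q + 1)
          * (\<Sum>m\<in>(Nh \<union> Nb - (L \<union> U)) \<union> {n}. v m) \<and>
      G \<subseteq> Nh \<and> card (Nh - G) = q \<and> (\<forall>m\<in>insert n G. 1 / (4 * (real (card Hon))\<^sup>2) \<le> Y m)"
proof -
  define N where "N = real (card Hon)"
  define K where "K = Nh \<union> Nb - (L \<union> U)"
  define Kh where "Kh = K \<inter> Nh"
  define Kb where "Kb = K \<inter> Nb"
  define Lh where "Lh = L \<inter> Nh"
  define Uh where "Uh = U \<inter> Nh"
  define D where "D = real (card K) + 1"
  \<comment> \<open>\<open>W\<close> and \<open>S\<close> are the weight to be moved and the
    corresponding weighted sum, both before the division by \<open>D\<close>.\<close>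
  define W where "W = real (card Kh) / 2 + real (card Kb)"
  define S where "S = (\<Sum>m\<in>Kh. v m) / 2 + (\<Sum>m\<in>Kb. v m)"
  define lo where "lo = (\<Sum>m\<in>Lh. v m) / card Lh"
  define hi where "hi = (\<Sum>m\<in>Uh. v m) / card Uh"
  have LU: "L \<subseteq> Nh \<union> Nb" "U \<subseteq> Nh \<union> Nb" "L \<inter> U = {}" "card L = q" "card U = q"
    and Lle: "\<And>i j. i \<in> L \<Longrightarrow> j \<in> Nh \<union> Nb - L \<Longrightarrow> v i \<le> v j"
    and Uge: "\<And>i j. i \<in> U \<Longrightarrow> j \<in> Nh \<union> Nb - U \<Longrightarrow> v j \<le> v i"
    using trim unfolding trim_sets_def by blast+
  have finNh: "finite Nh" using fin Nh finite_subset by blast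
  have finLU: "finite L" "finite U" using LU finNh fin(2) by (meson finite_UnI finite_subset)+
  have fins: "finite K" "finite Kh" "finite Kb" "finite Lh" "finite Uh"
    using finNh fin by (auto simp: K_def Kh_def Kb_def Lh_def Uh_def)
  have cardA: "card (Nh \<union> Nb) = card Nh + card Nb"
    using finNh fin(2) disj by (simp add: card_Un_disjoint)
  have cardLU: "card (L \<union> U) = 2 * q" using finLU LU by (simp add: card_Un_disjoint)
  have cardK: "card K = card Nh + card Nb - 2 * q"
    unfolding K_def using LU finLU cardA cardLU by (subst card_Diff_subset) auto
  have K_split: "K = Kh \<union> Kb" "Kh \<inter> Kb = {}" using disj by (auto simp: K_def Kh_def Kb_def)
  have cardKs: "card K = card Kh + card Kb" using K_split fins by (metis card_Un_disjoint)
  have W: "1 / 2 \<le> W" using cardK cardKs q by (simp add: W_def)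
  have "card Nh < card Hon"
    using Nh n fin by (intro psubset_card_mono) auto
  then have D: "0 < D" "D \<le> N" and qN: "real q \<le> N"
    using cardK q by (auto simp: D_def N_def)
  have Deq: "D = real (card Nh) + real (card Nb) - 2 * real q + 1"
    using cardK q by (simp add: D_def)
  \<comment> \<open>Each trimmed side has \<open>q\<close> members and there are fewer than
    \<open>q\<close> Byzantine neighbours. So both sides contain an honest agent, and
    \<open>lo\<close> and \<open>hi\<close> are averages over nonempty sets.\<close>
  have honest_trimmed: "1 \<le> card (X \<inter> Nh) \<and> card (X \<inter> Nh) \<le> q" if "X \<subseteq> Nh \<union> Nb" "card X = q" for X
  proof -
    have "finite X" using that finNh fin(2) by (meson finite_UnI finite_subset)
    moreover have "X = X \<inter> Nh \<union> X \<inter> Nb" using that by blast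
    ultimately have "q = card (X \<inter> Nh) + card (X \<inter> Nb)"
      using that(2) disj card_Un_disjoint[of "X \<inter> Nh" "X \<inter> Nb"] by fastforce
    moreover have "card (X \<inter> Nb) \<le> card Nb" using fin(2) by (intro card_mono) auto
    ultimately show ?thesis using q by linarith
  qed
  have cLh: "1 \<le> card Lh" "card Lh \<le> q" using honest_trimmed[of L] LU by (auto simp: Lh_def)
  have cUh: "1 \<le> card Uh" "card Uh \<le> q" using honest_trimmed[of U] LU by (auto simp: Uh_def)
  have lo_le: "lo \<le> v j" if "j \<in> K" for j
  proof -
    have "(\<Sum>m\<in>Lh. v m) \<le> (\<Sum>m\<in>Lh. v j)"
      using that by (intro sum_mono Lle) (auto simp: K_def Lh_def)
    then show ?thesis using cLh by (simp add: lo_def divide_le_eq mult.commute)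
  qed
  have hi_ge: "v j \<le> hi" if "j \<in> K" for j
  proof -
    have "(\<Sum>m\<in>Uh. v j) \<le> (\<Sum>m\<in>Uh. v m)"
      using that by (intro sum_mono Uge) (auto simp: K_def Uh_def)
    then show ?thesis using cUh by (simp add: hi_def le_divide_eq mult.commute)
  qed
  have "real (card Kh) * lo \<le> (\<Sum>m\<in>Kh. v m)" "real (card Kb) * lo \<le> (\<Sum>m\<in>Kb. v m)"
    using lo_le by (auto intro!: sum_bounded_below simp: Kh_def Kb_def)
  then have "W * lo \<le> S" by (simp add: W_def S_def algebra_simps)
  moreover have "(\<Sum>m\<in>Kh. v m) \<le> real (card Kh) * hi" "(\<Sum>m\<in>Kb. v m) \<le> real (card Kb) * hi"
    using hi_ge by (auto intro!: sum_bounded_above simp: Kh_def Kb_def)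
  then have "S \<le> W * hi" by (simp add: W_def S_def algebra_simps)
  ultimately have "lo \<le> S / W" "S / W \<le> hi"
    using W by (simp_all add: le_divide_eq divide_le_eq mult.commute)
  then obtain t where t: "0 \<le> t" "t \<le> 1" "S / W = t * lo + (1 - t) * hi"
    using convex_combination_ex by blast
  have S_eq: "S = W * t * lo + W * (1 - t) * hi" using t(3) W by (simp add: field_simps)
  \<comment> \<open>The moved weight is split into the fractions \<open>t\<close> and
    \<open>1 - t\<close> between the two trimmed groups and shared equally inside each
    group.\<close>
  define a where "a = W * t / card Lh"
  define c where "c = W * (1 - t) / card Uh"
  have ac0: "0 \<le> a" "0 \<le> c" using W t by (auto simp: a_def c_def)
  \<comment> \<open>The factor 1 gives all four terms the shape of
    \<open>sum_of_bool_mult\<close>.\<close>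
  define Y where "Y m = (1 * of_bool (m \<in> {n}) + 1 / 2 * of_bool (m \<in> Kh)
      + a * of_bool (m \<in> Lh) + c * of_bool (m \<in> Uh)) / D" for m
  have sub: "{n} \<subseteq> Hon" "Kh \<subseteq> Hon" "Lh \<subseteq> Hon" "Uh \<subseteq> Hon"
    using Nh n by (auto simp: Kh_def Lh_def Uh_def)
  have sumY: "(\<Sum>m\<in>Hon. Y m * f m) = (f n + sum f Kh / 2 + a * sum f Lh + c * sum f Uh) / D"
    for f :: "'a \<Rightarrow> real"
  proof -
    have "(\<Sum>m\<in>Hon. Y m * f m) = (\<Sum>m\<in>Hon. 1 * of_bool (m \<in> {n}) * f m
        + 1 / 2 * of_bool (m \<in> Kh) * f m + a * of_bool (m \<in> Lh) * f m
        + c * of_bool (m \<in> Uh) * f m) / D"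
      unfolding sum_divide_distrib by (intro sum.cong refl) (simp only: Y_def distrib_right times_divide_eq_left)
    also have "\<dots> = (1 * sum f {n} + 1 / 2 * sum f Kh + a * sum f Lh + c * sum f Uh) / D"
      by (simp only: sum.distrib sum_of_bool_mult[OF fin(1)] sub)
    finally show ?thesis by simp
  qed
  have "sum Y Hon = (1 + card Kh / 2 + a * card Lh + c * card Uh) / D"
    using sumY[of "\<lambda>_. 1"] by simp
  also have "a * card Lh = W * t" using cLh by (simp add: a_def)
  also have "c * card Uh = W * (1 - t)" using cUh by (simp add: c_def)
  also have "1 + card Kh / 2 + W * t + W * (1 - t) = D"
  proof -
    have "W * t + W * (1 - t) = W" by (simp add: algebra_simps)
    then show ?thesis using cardKs by (simp add: D_def W_def)
  qed
  finally have sum1: "sum Y Hon = 1" using D by simp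
  have n_notin: "n \<notin> K" using n notb by (auto simp: K_def)
  have "(\<Sum>m\<in>Hon. Y m * v m) = (v n + sum v Kh / 2 + W * t * lo + W * (1 - t) * hi) / D"
    by (simp add: sumY a_def c_def lo_def hi_def)
  also have "\<dots> = (v n + sum v Kh + sum v Kb) / D" using S_eq by (simp add: S_def)
  also have "sum v Kh + sum v Kb = sum v K"
    using K_split fins by (metis sum.union_disjoint)
  then have "v n + sum v Kh + sum v Kb = (\<Sum>m\<in>K \<union> {n}. v m)"
    using n_notin fins by simp
  finally have avg: "(\<Sum>m\<in>Hon. Y m * v m) = 1 / D * (\<Sum>m\<in>K \<union> {n}. v m)" by simp
  have Y0: "0 \<le> Y m" for m using ac0 D by (simp add: Y_def)
  have N1: "1 \<le> N" using D(1,2) cardK q by (simp add: D_def)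
  \<comment> \<open>Since \<open>D \<le> N\<close>, the normalisation costs at most a factor
    \<open>1 / N\<close>, so a numerator of \<open>1 / (4 * N)\<close> suffices.\<close>
  have Yge: "1 / (4 * N\<^sup>2) \<le> Y m" if "1 / (4 * N) \<le> 1 * of_bool (m \<in> {n}) + 1 / 2 * of_bool (m \<in> Kh)
      + a * of_bool (m \<in> Lh) + c * of_bool (m \<in> Uh)" for m
  proof -
    have "1 / (4 * N\<^sup>2) = 1 / (4 * N) / N" by (simp add: power2_eq_square)
    also have "\<dots> \<le> 1 / (4 * N) / D" using D N1 by (intro divide_left_mono) auto
    also have "\<dots> \<le> Y m" unfolding Y_def using that D by (intro divide_right_mono) auto
    finally show ?thesis .
  qed
  have small: "1 / (4 * N) \<le> 1 / 2" "1 / (4 * N) \<le> 1" using N1 by (auto simp: field_simps)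
  have Yn: "1 / (4 * N\<^sup>2) \<le> Y n" using small ac0 by (intro Yge) auto
  have YKh: "1 / (4 * N\<^sup>2) \<le> Y m" if "m \<in> Kh" for m using small ac0 that by (intro Yge) auto
  \<comment> \<open>One factor 1 / 2 comes from \<open>W\<close>, one from the larger of
    \<open>t\<close> and \<open>1 - t\<close>, and \<open>1 / N\<close> from sharing among at most
    \<open>q \<le> N\<close> agents.\<close>
  have share: "1 / (4 * N) \<le> W * p / k" if "1 / 2 \<le> p" "1 \<le> k" "k \<le> q" for p and k :: nat
  proof -
    have "1 / (4 * N) \<le> (1 / 4) / k" using that qN N1 by (simp add: field_simps)
    also have "(1 / 2) * (1 / 2) \<le> W * p" using W that by (intro mult_mono) auto
    then have "(1 / 4) / k \<le> W * p / k" by (intro divide_right_mono) auto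
    finally show ?thesis .
  qed
  \<comment> \<open>The trimmed group with the larger share has enough weight, so only honest agents
    in the opposite trimmed set may lack it.\<close>
  have "\<exists>X. X \<in> {L, U} \<and> (\<forall>m\<in>Nh - X. 1 / (4 * N\<^sup>2) \<le> Y m)"
  proof (cases "1 / 2 \<le> t")
    case True
    have "1 / (4 * N\<^sup>2) \<le> Y m" if "m \<in> Lh" for m
      using share[OF True cLh] that small ac0 by (intro Yge) (auto simp: a_def)
    then show ?thesis using YKh by (intro exI[of _ U]) (auto simp: Kh_def K_def Lh_def)
  next
    case False
    have "1 / (4 * N\<^sup>2) \<le> Y m" if "m \<in> Uh" for m
      using share[OF _ cUh, of "1 - t"] False that small ac0 by (intro Yge) (auto simp: c_def)
    then show ?thesis using YKh by (intro exI[of _ L]) (auto simp: Kh_def K_def Uh_def)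
  qed
  then obtain X where X: "X \<in> {L, U}" "\<And>m. m \<in> Nh - X \<Longrightarrow> 1 / (4 * N\<^sup>2) \<le> Y m" by blast
  \<comment> \<open>\<open>X\<close> may contain Byzantine agents, so \<open>Nh - X\<close> may be
    too large for a reduced graph. Shrinking it to \<open>G\<close> leaves exactly \<open>q\<close>
    honest neighbours removed.\<close>
  have "card Nh - q \<le> card (Nh - X)"
    using diff_card_le_card_Diff[of X Nh] X(1) LU finLU by auto
  then obtain G where G: "G \<subseteq> Nh - X" "card G = card Nh - q"
    using obtain_subset_with_card_n by metis
  have "card (Nh - G) = q"
    using G q finNh finite_subset[of G Nh] by (subst card_Diff_subset) auto
  with G X(2) Y0 sum1 avg Yn show ?thesis
    unfolding Deq K_def N_def by (intro exI[of _ Y] exI[of _ G]) auto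
qed

text \<open>The kept neighbour sets \<open>G n\<close> together form a reduced graph, whose root
  supplies the reachability in \<open>mixing\<close>. Received values \<open>v n m\<close> may
  depend on the receiver only for Byzantine \<open>m\<close>; \<open>e\<close> leaves room for the
  temporal-difference step.\<close>

lemma trimmed_mean_mixing:
  fixes x :: "'a \<Rightarrow> real"
  assumes net: "agent_network Hon Byz E"
    and conn: "\<And>E'. E' \<in> reduced_graphs Hon E q \<Longrightarrow> rooted_within Hon \<tau> E'"
    and q: "\<And>n. n \<in> Hon \<Longrightarrow> card (in_nbrs E Byz n) < q n \<and> 3 * q n < card (in_nbrs E Hon n)"
    and v: "\<And>n m. n \<in> Hon \<Longrightarrow> m \<in> Hon \<Longrightarrow> v n m = x m"
    and trim: "\<And>n. n \<in> Hon \<Longrightarrow> \<exists>L U. trim_sets (v n) (q n) (in_nbrs E (Hon \<union> Byz) n) L U \<and>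
        y n = 1 / (real (card (in_nbrs E Hon n)) + real (card (in_nbrs E Byz n)) - 2 * real (q n) + 1)
            * (\<Sum>m\<in>(in_nbrs E (Hon \<union> Byz) n - (L \<union> U)) \<union> {n}. v n m) + e n"
  shows "\<exists>Y. mixing Hon (1 / (4 * (real (card Hon))\<^sup>2)) Y \<and>
      (\<forall>n\<in>Hon. y n = (\<Sum>m\<in>Hon. Y n m * x m) + e n)"
proof -
  define w where "w = 1 / (4 * (real (card Hon))\<^sup>2)"
  have "\<exists>Y G. (\<forall>m. 0 \<le> Y m) \<and> sum Y Hon = 1 \<and> y n = (\<Sum>m\<in>Hon. Y m * x m) + e n \<and>
      G \<subseteq> in_nbrs E Hon n \<and> card (in_nbrs E Hon n - G) = q n \<and> (\<forall>m\<in>insert n G. w \<le> Y m)"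
    if n: "n \<in> Hon" for n
  proof -
    have un: "in_nbrs E (Hon \<union> Byz) n = in_nbrs E Hon n \<union> in_nbrs E Byz n"
      by (auto simp: in_nbrs_def)
    obtain L U where LU: "trim_sets (v n) (q n) (in_nbrs E Hon n \<union> in_nbrs E Byz n) L U"
      "y n = 1 / (real (card (in_nbrs E Hon n)) + real (card (in_nbrs E Byz n)) - 2 * real (q n) + 1)
            * (\<Sum>m\<in>(in_nbrs E Hon n \<union> in_nbrs E Byz n - (L \<union> U)) \<union> {n}. v n m) + e n"
      using trim[OF n] unfolding un by blast
    have "(n, n) \<notin> E" using net by (auto simp: agent_network_def irrefl_def)
    then have n_notin: "n \<notin> in_nbrs E Hon n" "n \<notin> in_nbrs E Byz n" by (auto simp: in_nbrs_def)
    have sets: "finite Hon" "finite (in_nbrs E Byz n)" "in_nbrs E Hon n \<subseteq> Hon"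
      "in_nbrs E Hon n \<inter> in_nbrs E Byz n = {}"
      using net by (auto simp: agent_network_def in_nbrs_def)
    from trimmed_mean_as_honest_average[OF sets(1-3) n n_notin(1) sets(4)
          conjunct1[OF q[OF n]] conjunct2[OF q[OF n]] LU(1) n_notin(2), folded w_def]
    obtain Y G where YG: "\<forall>m. 0 \<le> Y m" "sum Y Hon = 1"
      "(\<Sum>m\<in>Hon. Y m * v n m) =
        1 / (real (card (in_nbrs E Hon n)) + real (card (in_nbrs E Byz n)) - 2 * real (q n) + 1)
          * (\<Sum>m\<in>(in_nbrs E Hon n \<union> in_nbrs E Byz n - (L \<union> U)) \<union> {n}. v n m)"
      "G \<subseteq> in_nbrs E Hon n" "card (in_nbrs E Hon n - G) = q n" "\<forall>m\<in>insert n G. w \<le> Y m"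
      by (elim exE conjE) (rule that)
    moreover have "(\<Sum>m\<in>Hon. Y m * v n m) = (\<Sum>m\<in>Hon. Y m * x m)"
      using v[OF n] by (intro sum.cong) auto
    ultimately show ?thesis using LU(2) by (intro exI[of _ Y] exI[of _ G]) simp
  qed
  then obtain Y where "\<forall>n\<in>Hon. \<exists>G. (\<forall>m. 0 \<le> Y n m) \<and> sum (Y n) Hon = 1 \<and>
      y n = (\<Sum>m\<in>Hon. Y n m * x m) + e n \<and> G \<subseteq> in_nbrs E Hon n \<and>
      card (in_nbrs E Hon n - G) = q n \<and> (\<forall>m\<in>insert n G. w \<le> Y n m)"
    by (rule bchoice[OF ballI, THEN exE])
  from bchoice[OF this] obtain G where YG: "\<And>n. n \<in> Hon \<Longrightarrow> (\<forall>m. 0 \<le> Y n m) \<and> sum (Y n) Hon = 1 \<and>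
      y n = (\<Sum>m\<in>Hon. Y n m * x m) + e n \<and> G n \<subseteq> in_nbrs E Hon n \<and>
      card (in_nbrs E Hon n - G n) = q n \<and> (\<forall>m\<in>insert n (G n). w \<le> Y n m)"
    by (elim exE) blast
  define E' where "E' = {(m, n). n \<in> Hon \<and> m \<in> G n}"
  have "{m. (m, n) \<in> E \<inter> Hon \<times> Hon - E'} = in_nbrs E Hon n - G n" if "n \<in> Hon" for n
    using that by (auto simp: E'_def in_nbrs_def)
  moreover have "E' \<subseteq> E \<inter> Hon \<times> Hon" using YG by (fastforce simp: E'_def in_nbrs_def)
  ultimately have "E' \<in> reduced_graphs Hon E q" using YG by (simp add: reduced_graphs_def)
  then obtain r where r: "r \<in> Hon" "\<And>n. n \<in> Hon \<Longrightarrow> \<exists>j. (r, n) \<in> E' ^^ j"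
    using conn unfolding rooted_within_def by blast
  have sub: "E' \<subseteq> {(m, n). m \<in> Hon \<and> n \<in> Hon \<and> w \<le> Y n m}"
    using YG \<open>E' \<subseteq> E \<inter> Hon \<times> Hon\<close> by (fastforce simp: E'_def)
  have "(r, n) \<in> {(m, n). m \<in> Hon \<and> n \<in> Hon \<and> w \<le> Y n m}\<^sup>*" if "n \<in> Hon" for n
    using r(2)[OF that] rtrancl_mono[OF sub] relpow_imp_rtrancl by blast
  then have "mixing Hon w Y" using YG r(1) by (auto simp: mixing_def averaging_def)
  then show ?thesis using YG unfolding w_def by blast
qed

section \<open>Transitions of the Markov chain\<close>

text \<open>The law of the first \<open>k + 1\<close> states, with the newest state at the head so
  that the next transition can read it by \<open>hd\<close>.\<close>

primrec path_pmf :: "'s pmf \<Rightarrow> ('s \<Rightarrow> 's pmf) \<Rightarrow> nat \<Rightarrow> 's list pmf" where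
  "path_pmf \<rho>0 P 0 = map_pmf (\<lambda>s. [s]) \<rho>0"
| "path_pmf \<rho>0 P (Suc k) =
     bind_pmf (path_pmf \<rho>0 P k) (\<lambda>l. map_pmf (\<lambda>s. s # l) (P (hd l)))"

lemma pmf_bind_Cons:
  "pmf (bind_pmf Q (\<lambda>l. map_pmf (\<lambda>s. s # l) (f l))) (s # l) = pmf Q l * pmf (f l) s"
proof -
  have "pmf (map_pmf (\<lambda>s. s # l') (f l')) (s # l) = pmf (f l) s * indicator {l} l'" for l'
  proof (cases "l' = l")
    case True
    have "inj (\<lambda>s. s # l)" by (auto simp: inj_def)
    then show ?thesis using True pmf_map_inj'[of "\<lambda>s. s # l"] by simp
  next
    case False
    then show ?thesis by (auto intro!: pmf_map_outside)
  qed
  then show ?thesis by (simp add: pmf_bind measure_pmf_single)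
qed

lemma pmf_path_pmf:
  "pmf (path_pmf \<rho>0 P k) (map x (rev [0..<Suc k])) = pmf \<rho>0 (x 0) * (\<Prod>i<k. pmf (P (x i)) (x (Suc i)))"
proof (induction k)
  case 0
  have "inj (\<lambda>s. [s])" by (auto simp: inj_def)
  then show ?case using pmf_map_inj'[of "\<lambda>s. [s]"] by simp
next
  case (Suc k)
  have "map x (rev [0..<Suc (Suc k)]) = x (Suc k) # map x (rev [0..<Suc k])" by simp
  moreover have "hd (map x (rev [0..<Suc k])) = x k" by simp
  ultimately show ?case using Suc by (simp add: pmf_bind_Cons del: upt_Suc)
qed

lemma length_path_pmf: "l \<in> set_pmf (path_pmf \<rho>0 P k) \<Longrightarrow> length l = Suc k"
  by (induction k arbitrary: l) (auto simp: set_bind_pmf)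

text \<open>The law of a finite path has countable support even over an uncountable state space. The
  disjoint events of following one of these paths have the probabilities given by
  \<open>path_pmf\<close>, which add up to 1.\<close>

lemma markov_chain_AE_path:
  assumes "markov_chain M \<rho>0 P X"
  shows "AE \<omega> in M. map (\<lambda>i. X i \<omega>) (rev [0..<Suc k]) \<in> set_pmf (path_pmf \<rho>0 P k)"
proof -
  interpret prob_space M using assms by (simp add: markov_chain_def)
  define Q where "Q = path_pmf \<rho>0 P k"
  define Z where "Z \<omega> = map (\<lambda>i. X i \<omega>) (rev [0..<Suc k])" for \<omega>
  have X[measurable]: "X i \<in> M \<rightarrow>\<^sub>M count_space UNIV" for i
    using assms by (simp add: markov_chain_def)
  define B where "B l = {\<omega> \<in> space M. Z \<omega> = l}" for l
  have B: "B l \<in> sets M \<and> emeasure M (B l) = pmf Q l" if "length l = Suc k" for l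
  proof -
    \<comment> \<open>\<open>l\<close> has the newest state first; reversing it recovers the order
      of time.\<close>
    define x where "x i = rev l ! i" for i
    have l: "l = map x (rev [0..<Suc k])"
    proof (rule nth_equalityI)
      show "length l = length (map x (rev [0..<Suc k]))" using that by simp
      show "l ! i = map x (rev [0..<Suc k]) ! i" if "i < length l" for i
        using that \<open>length l = Suc k\<close> by (simp add: x_def rev_nth del: upt_Suc)
    qed
    have "B l = {\<omega> \<in> space M. \<forall>i\<le>k. X i \<omega> = x i}"
      unfolding B_def Z_def l by (auto simp del: upt_Suc simp: less_Suc_eq_le)
    moreover have "{\<omega> \<in> space M. \<forall>i\<le>k. X i \<omega> = x i} \<in> sets M" by measurable
    ultimately show ?thesis
      using assms pmf_path_pmf[of \<rho>0 P k x, folded l]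
      by (simp add: markov_chain_def emeasure_eq_measure Q_def)
  qed
  have BQ: "B l \<in> sets M" "emeasure M (B l) = emeasure Q {l}" if "l \<in> set_pmf Q" for l
    using B[of l] length_path_pmf[of l \<rho>0 P k] that by (simp_all add: Q_def emeasure_pmf_single)
  have "emeasure M (\<Union>l\<in>set_pmf Q. B l) = (\<integral>\<^sup>+l. emeasure M (B l) \<partial>count_space (set_pmf Q))"
    using BQ(1) by (intro emeasure_UN_countable countable_set_pmf) (auto simp: B_def disjoint_family_on_def)
  also have "\<dots> = (\<integral>\<^sup>+l. emeasure Q {l} \<partial>count_space (set_pmf Q))"
    using BQ(2) by (intro nn_integral_cong) simp
  also have "\<dots> = emeasure Q (set_pmf Q)"
    by (intro emeasure_countable_singleton[symmetric]) auto
  also have "\<dots> = 1" using measure_pmf.emeasure_eq_1_AE[of "set_pmf Q" Q] by (simp add: AE_measure_pmf)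
  finally have "prob (\<Union>l\<in>set_pmf Q. B l) = 1" by (simp add: emeasure_eq_measure)
  from AE_prob_1[OF this] show ?thesis
    by (rule AE_mp) (auto simp: B_def Z_def Q_def)
qed

text \<open>The reward bound covers only transitions of positive probability; this makes it
  available at all times on one almost sure event.\<close>

lemma markov_chain_AE_transition:
  assumes "markov_chain M \<rho>0 P X"
  shows "AE \<omega> in M. \<forall>k. pmf (P (X k \<omega>)) (X (Suc k) \<omega>) > 0"
proof -
  interpret prob_space M using assms by (simp add: markov_chain_def)
  have "AE \<omega> in M. pmf (P (X k \<omega>)) (X (Suc k) \<omega>) > 0" for k
  proof (rule AE_mp[OF markov_chain_AE_path[OF assms, of "Suc k"]], rule AE_I2, rule impI)
    fix \<omega> assume "map (\<lambda>i. X i \<omega>) (rev [0..<Suc (Suc k)]) \<in> set_pmf (path_pmf \<rho>0 P (Suc k))"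
    then have "pmf (path_pmf \<rho>0 P (Suc k)) (map (\<lambda>i. X i \<omega>) (rev [0..<Suc (Suc k)])) \<noteq> 0"
      unfolding set_pmf_iff .
    then show "pmf (P (X k \<omega>)) (X (Suc k) \<omega>) > 0"
      unfolding pmf_path_pmf by (simp add: pmf_positive_iff pmf_eq_0_set_pmf)
  qed
  then show ?thesis by (simp add: AE_all_countable)
qed

section \<open>The number of reduced graphs and the rate\<close>

text \<open>Size estimates for \<open>sqrt_one_minus_mu_le\<close>: the polynomial is the exponent
  of 2 in a bound for the square of \<open>N ^ 2 * (4 * N ^ 2) ^ (N * N)\<close>.\<close>

lemma square_and_cubic_le_power:
  fixes N :: nat
  assumes "5 \<le> N"
  shows "N\<^sup>2 \<le> 2 ^ N" "2 * N ^ 3 + 4 * N\<^sup>2 + 2 * N \<le> 4 ^ N"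
proof -
  show "N\<^sup>2 \<le> 2 ^ N" using assms
  proof (induction N rule: dec_induct)
    case (step n)
    have "2 * n + 1 \<le> n * n" using mult_le_mono1[OF step(1), of n] step(1) by linarith
    then show ?case using step by (simp add: power2_eq_square)
  qed simp
  show "2 * N ^ 3 + 4 * N\<^sup>2 + 2 * N \<le> 4 ^ N" using assms
  proof (induction N rule: dec_induct)
    case (step n)
    have "5 * n\<^sup>2 \<le> n * n\<^sup>2" "5 * n \<le> n * n" by (rule mult_le_mono1[OF step(1)])+
    moreover have "2 * Suc n ^ 3 + 4 * (Suc n)\<^sup>2 + 2 * Suc n = 2 * (n * n\<^sup>2) + 10 * n\<^sup>2 + 16 * n + 8"
      "2 * n ^ 3 = 2 * (n * n\<^sup>2)" "n\<^sup>2 = n * n" "4 ^ Suc n = 4 * (4 ^ n :: nat)"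
      by (simp_all add: power2_eq_square power3_eq_cube algebra_simps)
    ultimately show ?case using step(1,3) by linarith
  qed simp
qed

text \<open>The removed in-neighbours can be chosen independently at each honest agent, and the
  graph determines the removed sets, so different choices give different graphs.\<close>

lemma card_reduced_graphs_ge:
  assumes net: "agent_network Hon Byz E"
  shows "(\<Prod>n\<in>Hon. card (in_nbrs E Hon n) choose q n) \<le> card (reduced_graphs Hon E q)"
proof -
  have fin: "finite Hon" using net by (simp add: agent_network_def)
  have finR: "finite (reduced_graphs Hon E q)"
    by (rule finite_subset[of _ "Pow (Hon \<times> Hon)"]) (auto simp: reduced_graphs_def fin)
  have finN: "finite (in_nbrs E Hon n)" for n using fin by (simp add: in_nbrs_def)
  define T where "T n = {D. D \<subseteq> in_nbrs E Hon n \<and> card D = q n}" for n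
  define F where "F f = {(m, n). m \<in> in_nbrs E Hon n - f n \<and> n \<in> Hon}" for f :: "'a \<Rightarrow> 'a set"
  have removed: "{m. (m, n) \<in> E \<inter> Hon \<times> Hon - F f} = f n" if "f \<in> PiE Hon T" "n \<in> Hon" for f n
    using PiE_mem[OF that] that(2) by (auto simp: F_def T_def in_nbrs_def)
  have "inj_on F (PiE Hon T)"
  proof (rule inj_onI)
    fix f g assume f: "f \<in> PiE Hon T" and g: "g \<in> PiE Hon T" and eq: "F f = F g"
    show "f = g"
    proof (rule PiE_ext[OF f g])
      show "f n = g n" if "n \<in> Hon" for n
        using removed[OF f that] removed[OF g that] eq by simp
    qed
  qed
  moreover have "F ` PiE Hon T \<subseteq> reduced_graphs Hon E q"
  proof (rule image_subsetI)
    fix f assume f: "f \<in> PiE Hon T"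
    have "F f \<subseteq> E \<inter> Hon \<times> Hon" by (auto simp: F_def in_nbrs_def)
    moreover have "card (f n) = q n" if "n \<in> Hon" for n using PiE_mem[OF f that] by (simp add: T_def)
    ultimately show "F f \<in> reduced_graphs Hon E q" using removed[OF f] by (simp add: reduced_graphs_def)
  qed
  ultimately have "card (PiE Hon T) \<le> card (reduced_graphs Hon E q)"
    using finR by (metis card_inj_on_le)
  then show "(\<Prod>n\<in>Hon. card (in_nbrs E Hon n) choose q n) \<le> card (reduced_graphs Hon E q)"
    using fin finN by (simp add: card_PiE T_def n_subsets)
qed

text \<open>The lower bound \<open>(n / q) ^ q\<close> exceeds 3, and a binomial coefficient is an
  integer.\<close>

lemma choose_ge_4:
  assumes "1 \<le> q" "3 * q < n"
  shows "4 \<le> n choose q"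
proof -
  have "(3::real) < real n / real q" using assms by (simp add: field_simps)
  also have "\<dots> = (real n / real q) ^ 1" by simp
  also have "\<dots> \<le> (real n / real q) ^ q"
    using assms calculation by (intro power_increasing) auto
  also have "\<dots> \<le> real (n choose q)" using assms by (intro binomial_ge_n_over_k_pow_k) auto
  finally show ?thesis by simp
qed

text \<open>A larger \<open>t\<close> raises the base and lowers the exponent; as the base lies
  strictly between 0 and 1, both changes raise the power.\<close>

lemma strict_mono_on_one_minus_power_powr:
  fixes a :: real and H :: nat
  assumes a: "0 < a" "a < 1" and H: "0 < H"
  shows "strict_mono_on {1..} (\<lambda>t. (1 - a ^ (t * H)) powr (2 / real (t * H)))"
proof (rule strict_mono_onI)
  fix t u :: nat assume tu: "t \<in> {1..}" "u \<in> {1..}" "t < u"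
  define i where "i = t * H"
  define j where "j = u * H"
  have ij: "0 < i" "i < j" using tu H by (auto simp: i_def j_def)
  have lt: "a ^ j < a ^ i" using a ij by (intro power_strict_decreasing)
  have one: "a ^ i < 1" "0 < a ^ j" using a ij by (auto simp: power_less_one_iff)
  have "(1 - a ^ i) powr (2 / i) < (1 - a ^ j) powr (2 / i)"
    using lt one ij by (intro powr_less_mono2) auto
  also have "\<dots> \<le> (1 - a ^ j) powr (2 / j)"
    using lt one ij by (intro powr_mono') (auto intro!: divide_left_mono)
  finally show "(1 - a ^ (t * H)) powr (2 / real (t * H)) < (1 - a ^ (u * H)) powr (2 / real (u * H))"
    by (simp only: i_def j_def)
qed

section \<open>Disagreement of the iterates\<close>

text \<open>Strong induction by blocks of \<open>L\<close> steps. In units of the target, a block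
  contracts by at least \<open>L * e\<close>, the perturbations give back at most
  \<open>e / 2\<close> per step, and the target itself shrinks by at most a fraction
  \<open>e / 4\<close> per step, so the contraction wins.\<close>

lemma recursion_bound_by_steps:
  fixes V \<eta> :: "nat \<Rightarrow> real" and K e \<sigma> \<beta> \<alpha> :: real and L :: nat
  assumes eta: "\<And>k. 0 < \<eta> k" "\<And>k. \<eta> (Suc k) \<le> \<eta> k" "\<And>k. (1 - e / 4) * \<eta> k \<le> \<eta> (Suc k)"
    and e: "0 \<le> e" "e \<le> 1" "L * e \<le> \<alpha>" "\<alpha> \<le> 1"
    and K: "0 \<le> K" "\<sigma> \<le> K * e / 4"
    and \<beta>: "0 \<le> \<beta>" "\<And>k. \<beta> * \<eta> k \<le> e / 4"
    and V: "V 0 \<le> 0" "\<And>j. V j \<le> V 0 + (\<Sum>i<j. \<eta> i * (\<sigma> + \<beta> * V i))"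
      "\<And>k. V (k + L) \<le> (1 - \<alpha>) * V k + (\<Sum>i<L. \<eta> (k + i) * (\<sigma> + \<beta> * V (k + i)))"
    and L: "0 < L"
  shows "V k \<le> K * \<eta> k"
proof (induction k rule: less_induct)
  case (less k)
  have decr: "\<eta> (m + i) \<le> \<eta> m" for m i
    using eta(2) by (induction i) (auto intro: order_trans)
  have decay: "(1 - real i * e / 4) * \<eta> m \<le> \<eta> (m + i)" for m i
  proof (induction i)
    case (Suc i)
    have "(1 - real (Suc i) * e / 4) * \<eta> m \<le> (1 - e / 4) * ((1 - real i * e / 4) * \<eta> m)"
      using eta(1)[of m] e by (simp add: algebra_simps)
    also have "\<dots> \<le> (1 - e / 4) * \<eta> (m + i)" using Suc e by (intro mult_left_mono) auto
    also have "\<dots> \<le> \<eta> (m + Suc i)" using eta(3)[of "m + i"] by simp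
    finally show ?case .
  qed simp
  \<comment> \<open>By the induction hypothesis, \<open>\<sigma>\<close> and
    \<open>\<beta> * V\<close> contribute at most \<open>e / 4\<close> each per step, in units of
    \<open>K * \<eta> m\<close>.\<close>
  have pert: "(\<Sum>i<l. \<eta> (m + i) * (\<sigma> + \<beta> * V (m + i))) \<le> real l * (e / 2) * (K * \<eta> m)"
    if "m + l \<le> k" for l m
  proof -
    have "\<eta> (m + i) * (\<sigma> + \<beta> * V (m + i)) \<le> (e / 2) * (K * \<eta> m)" if "i < l" for i
    proof -
      have IH: "V (m + i) \<le> K * \<eta> (m + i)" using less \<open>m + l \<le> k\<close> that by simp
      have "\<eta> (m + i) * (\<sigma> + \<beta> * V (m + i)) \<le> \<eta> (m + i) * (K * e / 4 + \<beta> * (K * \<eta> (m + i)))"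
        using eta(1)[of "m + i"] K \<beta> IH by (intro mult_left_mono add_mono) auto
      also have "\<dots> = \<eta> (m + i) * K * (e / 4 + \<beta> * \<eta> (m + i))" by (simp add: algebra_simps)
      also have "\<dots> \<le> \<eta> (m + i) * K * (e / 2)"
        using eta(1)[of "m + i"] K \<beta>(2)[of "m + i"] by (intro mult_left_mono) auto
      also have "\<dots> \<le> \<eta> m * K * (e / 2)"
        using decr[of m i] K e by (intro mult_right_mono) auto
      finally show ?thesis by (simp add: algebra_simps)
    qed
    then have "(\<Sum>i<l. \<eta> (m + i) * (\<sigma> + \<beta> * V (m + i))) \<le> (\<Sum>i<l. (e / 2) * (K * \<eta> m))"
      by (intro sum_mono) auto
    then show ?thesis by (simp add: mult.assoc)
  qed
  \<comment> \<open>Allowing \<open>l \<le> L\<close> covers both a full block and the phase before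
    time \<open>L\<close>, where \<open>V 0 \<le> 0\<close> takes the place of the
    contraction.\<close>
  have combine: "real l * (e / 2) * (K * \<eta> m) + (1 - real L * e) * (K * \<eta> m) \<le> K * \<eta> (m + l)"
    if "l \<le> L" for l m
  proof -
    have le: "real l * e \<le> real L * e" using that e by (intro mult_right_mono) auto
    have "real l * (e / 2) + (1 - real L * e) \<le> 1 - real l * e / 4"
    proof -
      have "0 \<le> real l * e" using e by simp
      then show ?thesis using le by linarith
    qed
    then have "(real l * (e / 2) + (1 - real L * e)) * (K * \<eta> m) \<le> (1 - real l * e / 4) * (K * \<eta> m)"
      using K eta(1)[of m] by (intro mult_right_mono) auto
    also have "\<dots> \<le> K * \<eta> (m + l)"
      using mult_left_mono[OF decay[of l m] K(1)] by (simp add: algebra_simps)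
    finally show ?thesis by (simp add: algebra_simps)
  qed
  show ?case
  proof (cases "k < L")
    case True
    have "V k \<le> real k * (e / 2) * (K * \<eta> 0)" using V(1) V(2)[of k] pert[of 0 k] by simp
    moreover have "0 \<le> (1 - real L * e) * (K * \<eta> 0)" using e K eta(1)[of 0] by simp
    ultimately show ?thesis using combine[of k 0] True by simp
  next
    case False
    define m where "m = k - L"
    have k: "k = m + L" using False by (simp add: m_def)
    have "(1 - \<alpha>) * V m \<le> (1 - \<alpha>) * (K * \<eta> m)"
      using e less[of m] L k by (intro mult_left_mono) auto
    also have "\<dots> \<le> (1 - real L * e) * (K * \<eta> m)"
      using e K eta(1)[of m] by (intro mult_right_mono) auto
    finally have "(1 - \<alpha>) * V m \<le> (1 - real L * e) * (K * \<eta> m)" .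
    then show ?thesis using V(3)[of m] pert[of m L] combine[of L m] k by simp
  qed
qed

text \<open>Trimming acts on each coordinate separately, so contraction is available for
  coordinatewise spreads; their Euclidean norm dominates every pairwise distance.\<close>

definition disagreement :: "'a set \<Rightarrow> ('a \<Rightarrow> real ^ 'd) \<Rightarrow> real" where
  "disagreement A x = L2_set (\<lambda>d. spread A (\<lambda>n. x n $ d)) UNIV"

lemma norm_diff_le_disagreement:
  assumes "finite A" "n \<in> A" "m \<in> A"
  shows "norm (x n - x m) \<le> disagreement A x"
  unfolding disagreement_def norm_vec_def
  using abs_diff_le_spread[OF assms] by (intro L2_set_mono) auto

lemma disagreement_nonneg: "0 \<le> disagreement A x"
  by (simp add: disagreement_def)

text \<open>The spread of each coordinate is at most \<open>C\<close> times the size of that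
  coordinate of \<open>z\<close>, so the Euclidean norm reassembles \<open>norm z\<close> without a
  factor of the dimension.\<close>

lemma disagreement_common_direction_le:
  assumes "finite A" "A \<noteq> {}" "\<And>n. n \<in> A \<Longrightarrow> x n = c n *\<^sub>R z"
    and "\<And>n m. n \<in> A \<Longrightarrow> m \<in> A \<Longrightarrow> \<bar>c n - c m\<bar> \<le> C"
  shows "disagreement A x \<le> C * norm z"
proof -
  obtain a where "a \<in> A" using assms(2) by blast
  with assms(4)[of a a] have C: "0 \<le> C" by simp
  have "spread A (\<lambda>n. x n $ d) \<le> C * norm (z $ d)" for d
  proof (rule spread_le[OF assms(1,2)])
    fix n m assume nm: "n \<in> A" "m \<in> A"
    have "x n $ d - x m $ d = (c n - c m) * z $ d" using assms(3) nm by (simp add: algebra_simps)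
    also have "\<dots> \<le> \<bar>c n - c m\<bar> * \<bar>z $ d\<bar>" by (metis abs_ge_self abs_mult)
    also have "\<dots> \<le> C * norm (z $ d)" using assms(4)[OF nm] by (simp add: mult_right_mono)
    finally show "x n $ d - x m $ d \<le> C * norm (z $ d)" .
  qed
  then show ?thesis
    unfolding disagreement_def norm_vec_def L2_set_right_distrib[OF C]
    by (intro L2_set_mono spread_nonneg assms)
qed

lemma L2_set_sum_le: "L2_set (\<lambda>d. \<Sum>i<(j::nat). f i d) K \<le> (\<Sum>i<j. L2_set (f i) K)"
proof (induction j)
  case (Suc j)
  then show ?case
    using L2_set_triangle_ineq[of "\<lambda>d. \<Sum>i<j. f i d" "f j" K] by simp
qed (simp add: L2_set_def)

text \<open>The averaging matrices differ between coordinates but share the contraction factor, so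
  the scalar bounds combine by the triangle inequality for \<open>L2_set\<close>.\<close>

lemma
  fixes x e :: "nat \<Rightarrow> 'a \<Rightarrow> real ^ 'd"
  assumes fin: "finite A" and ne: "A \<noteq> {}" and w: "0 < w" "w \<le> 1"
    and mix: "\<And>j d. \<exists>Y. mixing A w Y \<and>
      (\<forall>n\<in>A. x (Suc j) n $ d = (\<Sum>m\<in>A. Y n m * (x j m $ d)) + e j n $ d)"
  shows disagreement_perturbed_le:
      "disagreement A (x j) \<le> disagreement A (x 0) + (\<Sum>i<j. disagreement A (e i))"
    and disagreement_perturbed_contract: "disagreement A (x (card A * card A)) \<le>
      (1 - w ^ (card A * card A)) * disagreement A (x 0) + (\<Sum>i<card A * card A. disagreement A (e i))"
proof -
  obtain Y where "\<And>j d. mixing A w (Y j d) \<and>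
      (\<forall>n\<in>A. x (Suc j) n $ d = (\<Sum>m\<in>A. Y j d n m * (x j m $ d)) + e j n $ d)"
    using mix by metis
  then have Y: "mixing A w (Y j d)"
      "n \<in> A \<Longrightarrow> x (Suc j) n $ d = (\<Sum>m\<in>A. Y j d n m * (x j m $ d)) + e j n $ d" for j d n
    by blast+
  have lift: "disagreement A y \<le> c * disagreement A (x 0) + (\<Sum>i<j. disagreement A (e i))"
    if "0 \<le> c" and "\<And>d. spread A (\<lambda>n. y n $ d)
        \<le> c * spread A (\<lambda>n. x 0 n $ d) + (\<Sum>i<j. spread A (\<lambda>n. e i n $ d))" for c j y
  proof -
    have "disagreement A y \<le> L2_set (\<lambda>d. c * spread A (\<lambda>n. x 0 n $ d)
        + (\<Sum>i<j. spread A (\<lambda>n. e i n $ d))) UNIV"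
      unfolding disagreement_def by (intro L2_set_mono that spread_nonneg fin ne)
    also have "\<dots> \<le> L2_set (\<lambda>d. c * spread A (\<lambda>n. x 0 n $ d)) UNIV
        + L2_set (\<lambda>d. \<Sum>i<j. spread A (\<lambda>n. e i n $ d)) UNIV"
      by (rule L2_set_triangle_ineq)
    also have "\<dots> \<le> c * disagreement A (x 0) + (\<Sum>i<j. disagreement A (e i))"
      unfolding disagreement_def L2_set_right_distrib[OF that(1)]
      by (intro add_mono order_refl L2_set_sum_le)
    finally show ?thesis .
  qed
  note bound = spread_perturbed_le[where Y="\<lambda>j. Y j d" and x="\<lambda>j n. x j n $ d"
      and e="\<lambda>j n. e j n $ d" and w=w for d,
      OF fin ne Y(1) w(1) Y(2)]
  note contr = spread_perturbed_contract[where Y="\<lambda>j. Y j d" and x="\<lambda>j n. x j n $ d"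
      and e="\<lambda>j n. e j n $ d" and w=w for d,
      OF fin ne Y(1) w(1) Y(2)]
  show "disagreement A (x j) \<le> disagreement A (x 0) + (\<Sum>i<j. disagreement A (e i))"
    using lift[of 1 "x j" j] bound by simp
  show "disagreement A (x (card A * card A)) \<le>
      (1 - w ^ (card A * card A)) * disagreement A (x 0) + (\<Sum>i<card A * card A. disagreement A (e i))"
    using w by (intro lift contr) (simp add: power_le_one)
qed

lemma avg_sq_dist_le_disagreement:
  assumes "finite A" "A \<noteq> {}"
  shows "avg A (\<lambda>n. (norm (x n - avg A x))\<^sup>2) \<le> (disagreement A x)\<^sup>2"
proof -
  have N: "0 < card A" using assms by (simp add: card_gt_0_iff)
  have "norm (x n - avg A x) \<le> disagreement A x" if "n \<in> A" for n
  proof -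
    have "x n - avg A x = (1 / card A) *\<^sub>R (\<Sum>m\<in>A. x n - x m)"
      using N by (simp add: avg_def sum_subtractf scaleR_right_diff_distrib sum_constant_scaleR
          del: sum_constant)
    also have "norm \<dots> \<le> (1 / card A) * (\<Sum>m\<in>A. norm (x n - x m))"
      by (simp add: divide_right_mono norm_sum)
    also have "\<dots> \<le> (1 / card A) * (\<Sum>m\<in>A. disagreement A x)"
      using norm_diff_le_disagreement[OF assms(1) that] by (intro mult_left_mono sum_mono) auto
    finally show ?thesis using N by simp
  qed
  then have "(\<Sum>n\<in>A. (norm (x n - avg A x))\<^sup>2) \<le> (\<Sum>n\<in>A. (disagreement A x)\<^sup>2)"
    by (intro sum_mono power_mono) auto
  then show ?thesis using N by (simp add: avg_def field_simps)
qed

section \<open>Size of the eligibility trace and of reward differences\<close>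

lemma norm_elig_trace_le:
  assumes "0 \<le> c" "c < 1" "\<And>s. norm (\<phi> s) \<le> 1"
  shows "norm (elig_trace c \<phi> s k) \<le> 1 / (1 - c)"
proof (induction k)
  case 0
  have "norm (\<phi> (s 0)) \<le> 1" by (rule assms(3))
  also have "1 \<le> 1 / (1 - c)" using assms(1,2) by simp
  finally show ?case by simp
next
  case (Suc k)
  have "norm (elig_trace c \<phi> s (Suc k)) \<le> c * norm (elig_trace c \<phi> s k) + norm (\<phi> (s (Suc k)))"
    using norm_triangle_ineq[of "c *\<^sub>R elig_trace c \<phi> s k" "\<phi> (s (Suc k))"] assms(1) by simp
  also have "\<dots> \<le> c * (1 / (1 - c)) + 1"
    using Suc assms by (intro add_mono mult_left_mono) auto
  also have "\<dots> = 1 / (1 - c)" using assms(2) by (simp add: field_simps)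
  finally show ?case .
qed

text \<open>One square is at most the sum of all, so each deviation from the mean is at most
  \<open>sqrt (card A) * \<bar>\<delta>\<bar>\<close>. Weakening this to
  \<open>card A * \<bar>\<delta>\<bar>\<close> fits the factor \<open>N ^ 2\<close> in the final
  constant.\<close>

lemma abs_diff_le_of_avg_sq_dist_le:
  fixes f :: "'a \<Rightarrow> real" and \<delta> :: real
  assumes fin: "finite A" and avg: "avg A (\<lambda>n. (norm (f n - avg A f))\<^sup>2) \<le> \<delta>\<^sup>2"
    and nm: "n \<in> A" "m \<in> A"
  shows "\<bar>f n - f m\<bar> \<le> 2 * card A * \<bar>\<delta>\<bar>"
proof -
  have N: "1 \<le> card A" using fin nm by (metis One_nat_def Suc_leI card_gt_0_iff empty_iff)
  have "\<bar>f i - avg A f\<bar> \<le> card A * \<bar>\<delta>\<bar>" if "i \<in> A" for i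
  proof -
    have "(f i - avg A f)\<^sup>2 \<le> (\<Sum>n\<in>A. (f n - avg A f)\<^sup>2)"
      using fin that by (intro member_le_sum) auto
    also have "\<dots> \<le> card A * \<delta>\<^sup>2" using avg N by (simp add: avg_def field_simps)
    also have "\<dots> \<le> (card A)\<^sup>2 * \<delta>\<^sup>2"
      using N by (intro mult_right_mono) (simp_all add: power2_eq_square flip: of_nat_mult)
    also have "\<dots> = (card A * \<bar>\<delta>\<bar>)\<^sup>2" by (simp add: power_mult_distrib)
    finally show ?thesis by (simp add: abs_le_square_iff[symmetric] abs_mult)
  qed
  from this[OF nm(1)] this[OF nm(2)] show ?thesis by linarith
qed

section \<open>The consensus error\<close>

text \<open>The last factor is at most 1 / 2 because at least one neighbour survives the trimming,
  and the first fraction is at most 1 because \<open>Bn \<le> qn\<close>. Positivity is decided by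
  the factor \<open>qn - Bn\<close>, all others being positive.\<close>

lemma mu0_bounds:
  assumes net: "agent_network Hon Byz E" and ne: "Hon \<noteq> {}"
    and trim: "\<And>n. n \<in> Hon \<Longrightarrow> card (in_nbrs E Byz n) \<le> q n \<and> 3 * q n < card (in_nbrs E Hon n)"
  shows "0 \<le> mu0 Hon Byz E q" "mu0 Hon Byz E q \<le> 1 / 2"
    and "0 < mu0 Hon Byz E q \<longleftrightarrow> (\<forall>n\<in>Hon. card (in_nbrs E Byz n) < q n)"
proof -
  define f where "f n = (let Nn = real (card (in_nbrs E Hon n)); Bn = real (card (in_nbrs E Byz n));
            qn = real (q n)
        in min ((Nn + Bn - 3 * qn) / (Nn - 2 * qn))
               ((Nn + Bn - 2 * qn) * (qn - Bn) / (Nn - qn)\<^sup>2)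
           * (1 / (Nn + Bn - 2 * qn + 1)))" for n
  have fin: "finite Hon" using net by (simp add: agent_network_def)
  have mu0: "mu0 Hon Byz E q = Min (f ` Hon)" by (simp add: mu0_def f_def)
  have f: "0 \<le> f n \<and> f n \<le> 1 / 2 \<and> (0 < f n \<longleftrightarrow> card (in_nbrs E Byz n) < q n)" if "n \<in> Hon" for n
  proof -
    define Nn where "Nn = real (card (in_nbrs E Hon n))"
    define Bn where "Bn = real (card (in_nbrs E Byz n))"
    define qn where "qn = real (q n)"
    define x where "x = (Nn + Bn - 3 * qn) / (Nn - 2 * qn)"
    define y where "y = (Nn + Bn - 2 * qn) * (qn - Bn) / (Nn - qn)\<^sup>2"
    define z where "z = 1 / (Nn + Bn - 2 * qn + 1)"
    have "real (3 * q n) < Nn" using trim[OF that] by (simp only: Nn_def of_nat_less_iff)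
    then have *: "3 * qn < Nn" "Bn \<le> qn" "0 \<le> Bn" "0 \<le> qn"
      using trim[OF that] by (auto simp: Bn_def qn_def)
    have "1 \<le> Nn + Bn - 2 * qn"
      using trim[OF that] by (simp add: Nn_def Bn_def qn_def)
    then have z: "0 < z" "z \<le> 1 / 2" by (auto simp: z_def field_simps)
    have x: "0 < x" "x \<le> 1" using * by (auto simp: x_def divide_le_eq intro!: divide_pos_pos)
    have y: "0 \<le> y" using * by (simp add: y_def)
    have "0 < y \<longleftrightarrow> Bn < qn" using * by (auto simp: y_def zero_less_divide_iff zero_less_mult_iff)
    then have pos: "0 < min x y * z \<longleftrightarrow> Bn < qn" using x z by (simp add: zero_less_mult_iff)
    have "min x y * z \<le> 1 * (1 / 2)" using x y z by (intro mult_mono) auto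
    then show ?thesis using pos x y z
      by (simp add: f_def Let_def x_def y_def z_def flip: Nn_def Bn_def qn_def)
        (simp add: Bn_def qn_def)
  qed
  from ne obtain n where n: "n \<in> Hon" by blast
  show "0 \<le> mu0 Hon Byz E q" unfolding mu0 using fin ne f by (intro Min.boundedI) auto
  have "Min (f ` Hon) \<le> f n" using fin n by (intro Min_le) auto
  then show "mu0 Hon Byz E q \<le> 1 / 2" unfolding mu0 using f[OF n] by linarith
  show "0 < mu0 Hon Byz E q \<longleftrightarrow> (\<forall>n\<in>Hon. card (in_nbrs E Byz n) < q n)"
    unfolding mu0 using fin ne f by (subst Min_gr_iff) auto
qed

text \<open>As \<open>2 / T \<le> 1\<close>, the difference under the root is at most
  \<open>a ^ T\<close>, which is doubly exponentially small in \<open>N\<close>. The right-hand side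
  of the last bound is at least a power of 1 / 2 with a cubic exponent.\<close>

lemma sqrt_one_minus_mu_le:
  fixes a :: real and N T :: nat
  assumes a: "0 < a" "a \<le> 1 / 2" and N: "5 \<le> N" and T: "4 ^ N \<le> T"
  defines "e \<equiv> sqrt (1 - (1 - a ^ T) powr (2 / real T))"
  shows "0 < e" "e \<le> 1" "real (N * N) * e \<le> (1 / (4 * (real N)\<^sup>2)) ^ (N * N)"
proof -
  have "(4::nat) ^ 1 \<le> 4 ^ N" using N by (intro power_increasing) auto
  then have T2: "2 \<le> T" using T by simp
  have aT: "0 < a ^ T" "a ^ T < 1" using a T2 by (auto simp: power_less_one_iff)
  define \<mu> where "\<mu> = (1 - a ^ T) powr (2 / real T)"
  have e: "e = sqrt (1 - \<mu>)" by (simp add: e_def \<mu>_def)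
  have "\<mu> < 1 powr (2 / real T)"
    unfolding \<mu>_def using aT T2 by (intro powr_less_mono2) auto
  then show "0 < e" by (simp add: e)
  show "e \<le> 1" by (simp add: e \<mu>_def)
  have "(1 - a ^ T) powr 1 \<le> \<mu>"
    unfolding \<mu>_def using aT T2 by (intro powr_mono') auto
  then have "1 - \<mu> \<le> a ^ T" using aT by simp
  also have "\<dots> \<le> (1 / 2) ^ T" using a by (intro power_mono) auto
  also have "\<dots> \<le> (1 / 2) ^ (4 ^ N)" using T by (intro power_decreasing) auto
  also have "\<dots> \<le> (1 / 2) ^ (2 * N ^ 3 + 4 * N\<^sup>2 + 2 * N)"
    using square_and_cubic_le_power(2)[OF N] by (intro power_decreasing) auto
  finally have mu_le: "1 - \<mu> \<le> (1 / 2) ^ (2 * N ^ 3 + 4 * N\<^sup>2 + 2 * N)" .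
  have "real (N\<^sup>2) \<le> real (2 ^ N)" using square_and_cubic_le_power(1)[OF N] by (simp only: of_nat_le_iff)
  then have N2: "(real N)\<^sup>2 \<le> 2 ^ N" by simp
  \<comment> \<open>Squaring removes the root, and \<open>N ^ 2 \<le> 2 ^ N\<close> turns
    \<open>4 * N ^ 2\<close> into at most \<open>2 ^ (N + 2)\<close>.\<close>
  have "(real (N * N))\<^sup>2 * (4 * (real N)\<^sup>2) ^ (2 * (N * N)) \<le> (2 ^ N)\<^sup>2 * (2 ^ (N + 2)) ^ (2 * (N * N))"
    using N2 by (intro mult_mono power_mono) (auto simp: power2_eq_square power_add)
  also have "\<dots> = (2::real) ^ (N * 2 + (N + 2) * (2 * (N * N)))"
    by (simp only: power_add power_mult)
  also have "N * 2 + (N + 2) * (2 * (N * N)) = 2 * N ^ 3 + 4 * N\<^sup>2 + 2 * N"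
    by (simp add: power2_eq_square power3_eq_cube algebra_simps)
  finally have big: "(real (N * N))\<^sup>2 * (4 * (real N)\<^sup>2) ^ (2 * (N * N))
      \<le> (2::real) ^ (2 * N ^ 3 + 4 * N\<^sup>2 + 2 * N)" (is "?l * ?r \<le> ?p") .
  have r: "0 < ?r" using N by simp
  have "(real (N * N) * e)\<^sup>2 = ?l * (1 - \<mu>)"
    using \<open>0 < e\<close> by (simp add: e power_mult_distrib)
  also have "\<dots> \<le> ?l * (1 / ?p)"
    using mu_le by (intro mult_left_mono) (auto simp: power_one_over)
  also have "\<dots> \<le> 1 / ?r" using big r by (simp add: field_simps)
  also have "\<dots> = ((1 / (4 * (real N)\<^sup>2)) ^ (N * N))\<^sup>2"
    by (simp only: power_one_over power_mult[symmetric] mult.commute)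
  finally show "real (N * N) * e \<le> (1 / (4 * (real N)\<^sup>2)) ^ (N * N)"
    by (rule power2_le_imp_le) simp
qed

theorem theorem1:
  fixes Hon Byz :: "'a set" and E :: "('a \<times> 'a) set" and q :: "'a \<Rightarrow> nat" and \<tau> :: nat
    and M :: "'w measure" and \<rho>0 :: "'s pmf" and P :: "'s \<Rightarrow> 's pmf" and X :: "nat \<Rightarrow> 'w \<Rightarrow> 's"
    and \<gamma> lam \<delta> :: real and \<phi> :: "'s \<Rightarrow> real ^ 'd" and R :: "'a \<Rightarrow> 's \<Rightarrow> 's \<Rightarrow> real"
    and \<eta> :: "nat \<Rightarrow> real" and \<theta>0 :: "real ^ 'd"
    and b :: "'w \<Rightarrow> nat \<Rightarrow> 'a \<Rightarrow> 'a \<Rightarrow> real ^ 'd" and \<theta> :: "'w \<Rightarrow> nat \<Rightarrow> 'a \<Rightarrow> real ^ 'd"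
  assumes network: "agent_network Hon Byz E"
    and gamma: "0 < \<gamma>" "\<gamma> < 1"
    and lambda: "0 \<le> lam" "lam \<le> 1"
    and chain: "markov_chain M \<rho>0 P X"
    and irreducible: "irreducible_kernel P"
    and aperiodic: "aperiodic_kernel P"
    and rewards: "\<And>s s'. pmf (P s) s' > 0 \<Longrightarrow>
          avg Hon (\<lambda>n. (norm (R n s s' - avg Hon (\<lambda>n'. R n' s s')))\<^sup>2) \<le> \<delta>\<^sup>2"
    and features: "\<And>s. norm (\<phi> s) \<le> 1"
    and connectivity: "\<And>E'. E' \<in> reduced_graphs Hon E q \<Longrightarrow> rooted_within Hon \<tau> E'"
    and trimming: "\<And>n. n \<in> Hon \<Longrightarrow>
          card (in_nbrs E Byz n) \<le> q n \<and> real (q n) < real (card (in_nbrs E Hon n)) / 3"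
    and step_pos: "\<And>k. \<eta> k > 0"
    and step_small: "\<And>k. 16 * (real (card Hon))\<^sup>2 * ((1 + \<gamma>) / (1 - \<gamma> * lam))\<^sup>2 * (\<eta> k)\<^sup>2
          \<le> (1 - mu Hon Byz E q \<tau>) / 2"
    and step_ratio: "\<And>k. k \<ge> 1 \<Longrightarrow>
          1 \<le> (\<eta> (k - 1) / \<eta> k)\<^sup>2 \<and> (\<eta> (k - 1) / \<eta> k)\<^sup>2 \<le> 4 / (3 + mu Hon Byz E q \<tau>)"
    and algorithm: "\<And>\<omega>. \<omega> \<in> space M \<Longrightarrow>
          byrd_td Hon Byz E q \<gamma> lam \<phi> R \<eta> \<theta>0 (\<lambda>k. X k \<omega>) (b \<omega>) (\<theta> \<omega>)"
  shows "(AE \<omega> in M. \<forall>k.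
            avg Hon (\<lambda>n. (norm (\<theta> \<omega> k n - avg Hon (\<theta> \<omega> k)))\<^sup>2)
              \<le> 1 / 2 * (128 * (real (card Hon))\<^sup>2 * \<delta>\<^sup>2 / (1 - \<gamma> * lam)\<^sup>2)
                  * (1 / (1 - mu Hon Byz E q \<tau>)) * (\<eta> k)\<^sup>2)
         \<and> strict_mono_on {1..} (\<lambda>t. mu Hon Byz E q t)"
proof -
  define N where "N = card Hon"
  define H where "H = card (reduced_graphs Hon E q)"
  define a where "a = mu0 Hon Byz E q"
  define \<mu> where "\<mu> = mu Hon Byz E q \<tau>"
  define e where "e = sqrt (1 - \<mu>)"
  define Z where "Z = 1 / (1 - \<gamma> * lam)"
  have fin: "finite Hon" using network by (simp add: agent_network_def)
  have trim: "card (in_nbrs E Byz n) \<le> q n \<and> 3 * q n < card (in_nbrs E Hon n)" if "n \<in> Hon" for n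
    using trimming[OF that] by linarith
  have mu_eq: "mu Hon Byz E q t = (1 - a ^ (t * H)) powr (2 / real (t * H))" for t
    by (simp add: mu_def a_def H_def Let_def)

  \<comment> \<open>Strict trimming, five honest agents and many reduced graphs\<close>
  have "0 < (\<Prod>n\<in>Hon. card (in_nbrs E Hon n) choose q n)"
    using trim by (intro prod_pos) (fastforce simp: zero_less_binomial_iff)
  then have H0: "0 < H" using card_reduced_graphs_ge[OF network, of q] by (simp add: H_def)
  then obtain E' where E': "E' \<in> reduced_graphs Hon E q"
    unfolding H_def by (metis card.empty equals0I less_numeral_extra(3))
  then have ne: "Hon \<noteq> {}" using connectivity by (fastforce simp: rooted_within_def)
  have N0: "0 < N" using fin ne by (simp add: N_def card_gt_0_iff)
  have nbrs: "card (in_nbrs E Hon n) < N" if "n \<in> Hon" for n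
  proof -
    have "in_nbrs E Hon n \<subset> Hon"
      using network that by (auto simp: agent_network_def irrefl_def in_nbrs_def)
    then show ?thesis unfolding N_def by (intro psubset_card_mono fin)
  qed
  \<comment> \<open>With diameter 0 the root would be the only honest agent and would have no honest
    neighbour, against the trimming condition.\<close>
  have \<tau>: "0 < \<tau>"
  proof (rule ccontr)
    assume "\<not> 0 < \<tau>"
    then obtain r where "\<forall>n\<in>Hon. r = n" using connectivity[OF E'] by (auto simp: rooted_within_def)
    then have "Hon \<subseteq> {r}" by auto
    then have "N \<le> 1" using card_mono[of "{r}" Hon] by (simp add: N_def)
    then show False using ne nbrs trim by fastforce
  qed
  have cl: "0 \<le> \<gamma> * lam" "\<gamma> * lam < 1"
    using gamma lambda mult_left_le[of lam \<gamma>] by (simp, linarith)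
  have Z0: "0 < Z" using cl by (simp add: Z_def)
  have small: "16 * (real N)\<^sup>2 * (Z * (1 + \<gamma>))\<^sup>2 * (\<eta> k)\<^sup>2 \<le> (1 - \<mu>) / 2" for k
    using step_small[of k] by (simp add: N_def Z_def \<mu>_def)
  have "0 < 16 * (real N)\<^sup>2 * (Z * (1 + \<gamma>))\<^sup>2 * (\<eta> 0)\<^sup>2"
    using N0 Z0 gamma step_pos[of 0] by simp
  from less_le_trans[OF this small] have mu_less: "\<mu> < 1" by simp
  have a_bounds: "0 \<le> a" "a \<le> 1 / 2" "0 < a \<longleftrightarrow> (\<forall>n\<in>Hon. card (in_nbrs E Byz n) < q n)"
    unfolding a_def by (rule mu0_bounds[OF network ne trim]; assumption)+
  \<comment> \<open>Here positivity of \<open>\<tau> * H\<close> matters: it makes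
    \<open>0 ^ (\<tau> * H)\<close> vanish, so that \<open>a = 0\<close> would give
    \<open>\<mu> = 1\<close>.\<close>
  have "a \<noteq> 0"
  proof
    assume "a = 0"
    then have "\<mu> = 1" using \<tau> H0 by (simp add: \<mu>_def mu_eq power_0_left)
    with mu_less show False by simp
  qed
  with a_bounds have a0: "0 < a" and Bq: "\<And>n. n \<in> Hon \<Longrightarrow> card (in_nbrs E Byz n) < q n" by auto
  \<comment> \<open>Strict trimming gives \<open>q n \<ge> 1\<close>, so an honest agent has at
    least 4 honest neighbours besides itself.\<close>
  have N5: "5 \<le> N"
  proof -
    obtain n where "n \<in> Hon" using ne by blast
    then show ?thesis using nbrs[of n] trim[of n] Bq[of n] by linarith
  qed
  have choose: "4 \<le> card (in_nbrs E Hon n) choose q n" if "n \<in> Hon" for n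
    using trim[OF that] Bq[OF that] by (intro choose_ge_4) auto
  have "4 ^ N = (\<Prod>n\<in>Hon. 4::nat)" by (simp add: N_def)
  also have "\<dots> \<le> (\<Prod>n\<in>Hon. card (in_nbrs E Hon n) choose q n)"
    using choose by (intro prod_mono) auto
  also have "\<dots> \<le> H" unfolding H_def by (rule card_reduced_graphs_ge[OF network])
  also have "H \<le> \<tau> * H" using \<tau> by simp
  finally have T: "4 ^ N \<le> \<tau> * H" .
  have e: "0 < e" "e \<le> 1" "real (N * N) * e \<le> (1 / (4 * (real N)\<^sup>2)) ^ (N * N)"
    using sqrt_one_minus_mu_le[OF a0 a_bounds(2) N5 T] by (simp_all only: e_def \<mu>_def mu_eq)
  have e2: "e\<^sup>2 = 1 - \<mu>" using mu_less by (simp add: e_def)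
  define w where "w = 1 / (4 * (real N)\<^sup>2)"
  have w: "0 < w" "w \<le> 1" using N0 by (auto simp: w_def divide_le_eq intro: order_trans[of _ 4])

  \<comment> \<open>\<open>K ^ 2\<close> is the claimed constant, and
    \<open>\<sigma> = K * e / 4\<close> holds exactly. Per unit of step size,
    \<open>\<sigma>\<close> bounds the effect of reward differences, and \<open>\<beta>\<close> the
    effect of one unit of present disagreement.\<close>
  define K where "K = 8 * real N * \<bar>\<delta>\<bar> * Z / e"
  define \<sigma> where "\<sigma> = Z * (2 * real N * \<bar>\<delta>\<bar>)"
  define \<beta> where "\<beta> = Z * (1 + \<gamma>)"
  have K0: "0 \<le> K" using Z0 e by (simp add: K_def)
  have \<sigma>: "\<sigma> \<le> K * e / 4" using e by (simp add: K_def \<sigma>_def)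
  have \<beta>0: "0 \<le> \<beta>" using Z0 gamma by (simp add: \<beta>_def)
  have \<beta>: "\<beta> * \<eta> k \<le> e / 4" for k
  proof -
    have "1 * (\<beta> * \<eta> k)\<^sup>2 \<le> (real N)\<^sup>2 * (\<beta> * \<eta> k)\<^sup>2"
      using N0 by (intro mult_right_mono) auto
    also have "\<dots> \<le> e\<^sup>2 / 32"
      using small[of k, folded \<beta>_def] by (simp add: e2 power_mult_distrib mult.assoc)
    also have "\<dots> \<le> (e / 4)\<^sup>2" by (simp add: power_divide)
    finally have "(\<beta> * \<eta> k)\<^sup>2 \<le> (e / 4)\<^sup>2" by simp
    then show ?thesis by (rule power2_le_imp_le) (use e in simp)
  qed
  have decr: "\<eta> (Suc k) \<le> \<eta> k" for k
  proof -
    have "1 \<le> (\<eta> k / \<eta> (Suc k))\<^sup>2" using step_ratio[of "Suc k"] by simp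
    then have "(\<eta> (Suc k))\<^sup>2 \<le> (\<eta> k)\<^sup>2"
      using step_pos[of "Suc k"] by (simp add: power_divide le_divide_eq)
    then show ?thesis using step_pos[of k] by (meson less_imp_le power2_le_imp_le)
  qed
  \<comment> \<open>In terms of \<open>e\<close> the bound on the squared ratio is
    \<open>4 / (4 - e ^ 2)\<close>, and \<open>(1 - e / 4) ^ 2 \<le> 1 - e ^ 2 / 4\<close> follows
    from \<open>e ^ 2 \<le> e\<close>.\<close>
  have decay: "(1 - e / 4) * \<eta> k \<le> \<eta> (Suc k)" for k
  proof (rule power2_le_imp_le)
    have "(\<eta> k / \<eta> (Suc k))\<^sup>2 \<le> 4 / (4 - e\<^sup>2)" using step_ratio[of "Suc k"] by (simp add: e2 \<mu>_def)
    moreover have e21: "0 < 4 - e\<^sup>2" using e power_le_one[of e 2] by simp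
    ultimately have *: "(4 - e\<^sup>2) * (\<eta> k)\<^sup>2 \<le> 4 * (\<eta> (Suc k))\<^sup>2"
      using step_pos[of "Suc k"] by (simp add: power_divide divide_le_eq le_divide_eq algebra_simps)
    have "e * e \<le> e" using e by (simp add: mult_left_le)
    then have "(1 - e / 4)\<^sup>2 \<le> (4 - e\<^sup>2) / 4" using e by (simp add: power2_eq_square algebra_simps)
    then have "(1 - e / 4)\<^sup>2 * (\<eta> k)\<^sup>2 \<le> (4 - e\<^sup>2) / 4 * (\<eta> k)\<^sup>2" by (intro mult_right_mono) auto
    then show "((1 - e / 4) * \<eta> k)\<^sup>2 \<le> (\<eta> (Suc k))\<^sup>2" using * by (simp add: power_mult_distrib)
    show "0 \<le> \<eta> (Suc k)" using step_pos[of "Suc k"] by simp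
  qed

  \<comment> \<open>The consensus bound along one sample path\<close>
  have path: "avg Hon (\<lambda>n. (norm (\<theta> \<omega> k n - avg Hon (\<theta> \<omega> k)))\<^sup>2)
              \<le> 1 / 2 * (128 * (real (card Hon))\<^sup>2 * \<delta>\<^sup>2 / (1 - \<gamma> * lam)\<^sup>2)
                  * (1 / (1 - mu Hon Byz E q \<tau>)) * (\<eta> k)\<^sup>2"
    if \<omega>: "\<omega> \<in> space M" and trans: "\<forall>k. 0 < pmf (P (X k \<omega>)) (X (Suc k) \<omega>)" for \<omega> k
  proof -
    define s where "s = (\<lambda>k. X k \<omega>)"
    define x where "x = \<theta> \<omega>"
    define g where "g k n = \<eta> k *\<^sub>R td_dir \<gamma> lam \<phi> (R n) s k (x k n)" for k n
    define V where "V k = disagreement Hon (x k)" for k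
    have alg: "byrd_td Hon Byz E q \<gamma> lam \<phi> R \<eta> \<theta>0 s (b \<omega>) x"
      using algorithm[OF \<omega>] by (simp add: s_def x_def)
    have mix: "\<exists>Y. mixing Hon w Y \<and>
        (\<forall>n\<in>Hon. x (Suc k) n $ d = (\<Sum>m\<in>Hon. Y n m * (x k m $ d)) + g k n $ d)" for k d
      unfolding w_def N_def
    proof (rule trimmed_mean_mixing[OF network connectivity,
          where v="\<lambda>n m. received Hon x (b \<omega>) k n m $ d"])
      show "\<exists>L U. trim_sets (\<lambda>m. received Hon x (b \<omega>) k n m $ d) (q n) (in_nbrs E (Hon \<union> Byz) n) L U \<and>
          x (Suc k) n $ d =
          1 / (real (card (in_nbrs E Hon n)) + real (card (in_nbrs E Byz n)) - 2 * real (q n) + 1)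
            * (\<Sum>m\<in>(in_nbrs E (Hon \<union> Byz) n - (L \<union> U)) \<union> {n}. received Hon x (b \<omega>) k n m $ d)
            + g k n $ d" if "n \<in> Hon" for n
        using alg that unfolding byrd_td_def g_def by simp
    qed (use trim Bq in \<open>auto simp: received_def\<close>)
    \<comment> \<open>All agents move along the same trace \<open>z\<close>; their coefficients
      differ by the rewards and by \<open>\<psi>\<close> applied to the difference of the
      iterates.\<close>
    have dis_g: "disagreement Hon (g k) \<le> \<eta> k * (\<sigma> + \<beta> * V k)" for k
    proof -
      define \<psi> where "\<psi> = \<gamma> *\<^sub>R \<phi> (s (Suc k)) - \<phi> (s k)"
      define r where "r = (\<lambda>n. R n (s k) (s (Suc k)))"
      define z where "z = elig_trace (\<gamma> * lam) \<phi> s k"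
      define C where "C = \<eta> k * (2 * real N * \<bar>\<delta>\<bar> + (1 + \<gamma>) * V k)"
      have "norm \<psi> \<le> \<gamma> * norm (\<phi> (s (Suc k))) + norm (\<phi> (s k))"
        using norm_triangle_ineq4[of "\<gamma> *\<^sub>R \<phi> (s (Suc k))" "\<phi> (s k)"] gamma by (simp add: \<psi>_def)
      also have "\<dots> \<le> \<gamma> * 1 + 1" using features gamma by (intro add_mono mult_left_mono) auto
      finally have \<psi>: "norm \<psi> \<le> 1 + \<gamma>" by simp
      have "avg Hon (\<lambda>n. (norm (r n - avg Hon r))\<^sup>2) \<le> \<delta>\<^sup>2"
        using rewards trans by (simp add: r_def s_def)
      note r = abs_diff_le_of_avg_sq_dist_le[OF fin this]
      have "disagreement Hon (g k) \<le> C * norm z"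
      proof (rule disagreement_common_direction_le[OF fin ne])
        show "g k n = (\<eta> k * (r n + \<psi> \<bullet> x k n)) *\<^sub>R z" for n
          by (simp add: g_def td_dir_def r_def \<psi>_def z_def)
        fix n m assume nm: "n \<in> Hon" "m \<in> Hon"
        have "\<bar>\<psi> \<bullet> (x k n - x k m)\<bar> \<le> norm \<psi> * norm (x k n - x k m)"
          by (rule Cauchy_Schwarz_ineq2)
        also have "\<dots> \<le> (1 + \<gamma>) * V k"
          unfolding V_def using \<psi> gamma norm_diff_le_disagreement[OF fin nm] by (intro mult_mono) auto
        finally have "\<bar>(r n - r m) + \<psi> \<bullet> (x k n - x k m)\<bar> \<le> 2 * real N * \<bar>\<delta>\<bar> + (1 + \<gamma>) * V k"
          using r[OF nm] by (simp add: N_def)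
        then have "\<eta> k * \<bar>(r n - r m) + \<psi> \<bullet> (x k n - x k m)\<bar> \<le> C"
          unfolding C_def using step_pos[of k] by (intro mult_left_mono) auto
        moreover have "\<eta> k * (r n + \<psi> \<bullet> x k n) - \<eta> k * (r m + \<psi> \<bullet> x k m)
            = \<eta> k * ((r n - r m) + \<psi> \<bullet> (x k n - x k m))"
          by (simp add: algebra_simps inner_diff_right)
        ultimately show "\<bar>\<eta> k * (r n + \<psi> \<bullet> x k n) - \<eta> k * (r m + \<psi> \<bullet> x k m)\<bar> \<le> C"
          using step_pos[of k] by (simp add: abs_mult)
      qed
      also have "\<dots> \<le> C * Z"
        unfolding C_def z_def Z_def using step_pos[of k] gamma disagreement_nonneg[of Hon "x k"]
        by (intro mult_left_mono norm_elig_trace_le cl features) (auto simp: V_def)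
      finally show ?thesis by (simp add: C_def \<sigma>_def \<beta>_def algebra_simps)
    qed
    have "V k \<le> K * \<eta> k"
    proof (rule recursion_bound_by_steps[where L="N * N" and \<alpha>="w ^ (N * N)" and \<eta>=\<eta> and e=e
            and K=K and \<sigma>=\<sigma> and \<beta>=\<beta> and V=V,
          OF step_pos decr decay _ e(2) e(3)[folded w_def] _ K0 \<sigma> \<beta>0 \<beta>])
      show "0 \<le> e" "w ^ (N * N) \<le> 1" "0 < N * N" using e w N0 by (auto simp: power_le_one)
      show "V 0 \<le> 0"
        unfolding V_def disagreement_def
      proof -
        have "spread Hon (\<lambda>n. x 0 n $ d) \<le> 0" for d
          using alg by (intro spread_le fin ne) (simp add: byrd_td_def)
        then have "spread Hon (\<lambda>n. x 0 n $ d) = 0" for d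
          using spread_nonneg[OF fin ne] by (intro antisym)
        then show "L2_set (\<lambda>d. spread Hon (\<lambda>n. x 0 n $ d)) UNIV \<le> 0" by (simp add: L2_set_def)
      qed
      fix j
      have "V j \<le> V 0 + (\<Sum>i<j. disagreement Hon (g i))"
        unfolding V_def by (rule disagreement_perturbed_le[where x=x and e=g, OF fin ne w mix])
      also have "\<dots> \<le> V 0 + (\<Sum>i<j. \<eta> i * (\<sigma> + \<beta> * V i))"
        by (intro add_left_mono sum_mono dis_g)
      finally show "V j \<le> V 0 + (\<Sum>i<j. \<eta> i * (\<sigma> + \<beta> * V i))" .
      \<comment> \<open>The run restarted at time \<open>j\<close> has the same form, so the
        contraction applies from any time.\<close>
      have mix': "\<exists>Y. mixing Hon w Y \<and>
        (\<forall>n\<in>Hon. x (j + Suc i) n $ d = (\<Sum>m\<in>Hon. Y n m * (x (j + i) m $ d)) + g (j + i) n $ d)" for i d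
        using mix[of "j + i" d] by simp
      have "V (j + N * N) \<le> (1 - w ^ (N * N)) * V j + (\<Sum>i<N * N. disagreement Hon (g (j + i)))"
        using disagreement_perturbed_contract[where x="\<lambda>i. x (j + i)" and e="\<lambda>i. g (j + i)", OF fin ne w mix']
        by (simp add: V_def N_def)
      also have "\<dots> \<le> (1 - w ^ (N * N)) * V j + (\<Sum>i<N * N. \<eta> (j + i) * (\<sigma> + \<beta> * V (j + i)))"
        by (intro add_left_mono sum_mono dis_g)
      finally show "V (j + N * N) \<le> (1 - w ^ (N * N)) * V j
          + (\<Sum>i<N * N. \<eta> (j + i) * (\<sigma> + \<beta> * V (j + i)))" .
    qed
    then have "(V k)\<^sup>2 \<le> (K * \<eta> k)\<^sup>2"
      using disagreement_nonneg[of Hon "x k"] by (intro power_mono) (auto simp: V_def)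
    also have "\<dots> = 1 / 2 * (128 * (real (card Hon))\<^sup>2 * \<delta>\<^sup>2 / (1 - \<gamma> * lam)\<^sup>2)
                  * (1 / (1 - mu Hon Byz E q \<tau>)) * (\<eta> k)\<^sup>2"
      unfolding N_def[symmetric] \<mu>_def[symmetric] e2[symmetric]
      by (simp add: K_def Z_def power_mult_distrib power_divide)
    finally show ?thesis
      using avg_sq_dist_le_disagreement[OF fin ne, of "x k"] by (simp add: V_def x_def)
  qed
  have "AE \<omega> in M. \<forall>k. avg Hon (\<lambda>n. (norm (\<theta> \<omega> k n - avg Hon (\<theta> \<omega> k)))\<^sup>2)
              \<le> 1 / 2 * (128 * (real (card Hon))\<^sup>2 * \<delta>\<^sup>2 / (1 - \<gamma> * lam)\<^sup>2)
                  * (1 / (1 - mu Hon Byz E q \<tau>)) * (\<eta> k)\<^sup>2"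
    by (rule AE_mp[OF markov_chain_AE_transition[OF chain] AE_I2]) (blast intro: path)
  \<comment> \<open>With the graph and the trimming numbers fixed, \<open>a\<close> and
    \<open>H\<close> do not change with \<open>t\<close>.\<close>
  moreover have "strict_mono_on {1..} (\<lambda>t. mu Hon Byz E q t)"
    unfolding mu_eq using a0 a_bounds(2) H0 by (intro strict_mono_on_one_minus_power_powr) auto
  ultimately show ?thesis by blast
qed

end
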